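(* There is a positive constant $c>0$ such that for every (real or complex) algebraic number $\lambda\in\overline{\mathbb{Q}}$, $$c\min\{1,\log M_\lambda\}\leq h_\lambda\leq\min\{1,\log M_\lambda\}.$$
   Context: Throughout $\log$ is the base $2$ logarithm. Mahler measure: if $\pi_\lambda=a_r\prod_{i=1}^r(X-\lambda_i)\in\mathbb{Z}[X]$ is the minimal polynomial (irreducible in $\mathbb{Z}[X]$) of the algebraic number $\lambda$, then $M_\lambda=|a_r|\prod_{|\lambda_i|>1}|\lambda_i|$. Let $\xi_0,\xi_1,\ldots$ be independent random variables, each equal to $+1$ or $-1$ with probability $1/2$, and let $\mu_\lambda^{(n)}$ be the law of the random variable $\sum_{i=0}^{n-1}\xi_i\lambda^i$. The entropy $h_\lambda$ is $$h_\lambda:=\lim_{n\to\infty}\frac{H(\mu_\lambda^{(n)})}{n},$$ where $H(\theta)=-\sum_x\theta(\{x\})\log\theta(\{x\})$ is the Shannon entropy of a discrete probability measure $\theta$. *)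

theory Defs
  imports "HOL-Probability.Probability" "Berlekamp_Zassenhaus.Mahler_Measure"
begin

text \<open>
  Irreducibility is taken in the ring of integer polynomials, so the polynomial is primitive. It is
  determined up to sign only, which is why it is picked with \<open>SOME\<close>.
\<close>

definition int_minpoly :: "complex \<Rightarrow> int poly" where
  "int_minpoly a = (SOME p. irreducible p \<and> poly (map_poly of_int p) a = 0)"

text \<open>
  The library's \<^const>\<open>mahler_measure\<close> of an integer polynomial is the absolute value of the leading
  coefficient times the product of \<open>max 1 (cmod z)\<close> over the complex roots \<open>z\<close>, so only the roots
  outside the closed unit disc contribute.
\<close>

definition mahler_measure_of :: "complex \<Rightarrow> real" where
  "mahler_measure_of a = mahler_measure (int_minpoly a)"

text \<open>
  \<^const>\<open>Pi_pmf\<close> makes the coordinates \<open>\<xi> 0, \<dots>, \<xi> (n - 1)\<close> independent; outside \<open>{..<n}\<close> they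
  have the irrelevant default value \<open>0\<close>.
\<close>

definition bernoulli_sum_pmf :: "complex \<Rightarrow> nat \<Rightarrow> complex pmf" where
  "bernoulli_sum_pmf a n =
     map_pmf (\<lambda>\<xi>. \<Sum>i<n. \<xi> i * a ^ i) (Pi_pmf {..<n} 0 (\<lambda>_. pmf_of_set {1, -1}))"

definition shannon_entropy :: "'a pmf \<Rightarrow> real" where
  "shannon_entropy \<theta> = - (\<Sum>\<^sub>\<infinity>x\<in>set_pmf \<theta>. pmf \<theta> x * log 2 (pmf \<theta> x))"

text \<open>
  The entropies are subadditive in \<open>n\<close>, so the limit exists. The term for \<open>n = 0\<close> is \<open>0\<close> and does
  not matter.
\<close>

definition bernoulli_entropy :: "complex \<Rightarrow> real" where
  "bernoulli_entropy a = lim (\<lambda>n. shannon_entropy (bernoulli_sum_pmf a n) / real n)"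

end

theory Submission
  imports Defs "HOL-Real_Asymp.Real_Asymp"
begin

text \<open>
  Write \<open>\<lambda>\<close> for the algebraic number, \<open>\<pi>\<close> for its integral minimal polynomial and \<open>M\<close> for its
  Mahler measure. A sign sequence \<open>\<xi>\<close> of length \<open>n\<close> is an integer polynomial \<open>p\<close> with coefficients
  \<open>\<plusminus>1\<close> (\<open>sign_polys n\<close>), and the random sum is the value \<open>p(\<lambda>)\<close> of a uniformly chosen one. Such
  a polynomial splits uniquely as \<open>p + X\<^sup>m q\<close>, so the entropies are subadditive and, by Fekete's
  lemma, the normalised entropies converge (\<open>bernoulli_entropy_LIMSEQ\<close>). There are \<open>2\<^sup>n\<close>
  polynomials, whence the upper bound \<open>1\<close>.

  \<^bold>\<open>The upper bound \<open>log M\<close>.\<close> It suffices to bound the number of values \<open>p(\<lambda>)\<close>, and one may assume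
  that \<open>\<pi>\<close> has leading coefficient \<open>\<plusminus>1\<close>, for otherwise \<open>log M \<ge> 1\<close>. Then division by \<open>\<pi>\<close> keeps
  coefficients integral, and by Lagrange interpolation the remainder of an integer polynomial that
  is very small at all roots of \<open>\<pi>\<close> has coefficients of absolute value below \<open>1\<close>, so it vanishes
  (\<open>small_at_roots_imp_dvd\<close>). Hence \<open>p(\<lambda>)\<close> is determined by the cell of a fixed mesh that contains
  the values of \<open>p\<close> at the roots \<open>z\<close> of \<open>\<pi>\<close>. These values are bounded by \<open>n max(1, |z|)\<^sup>n\<close>, so the
  number of cells is at most a polynomial in \<open>n\<close> times \<open>M\<^sup>n\<close> (\<open>card_values_le_mahler\<close>).

  \<^bold>\<open>The lower bound.\<close> Shannon entropy is at least the logarithm of the inverse collision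
  probability, that is, of the probability that \<open>p(\<lambda>) = q(\<lambda>)\<close> for independent \<open>p\<close> and \<open>q\<close>. If the
  leading coefficient of \<open>\<pi>\<close> is not \<open>\<plusminus>1\<close>, there are no collisions except \<open>p = q\<close>. Otherwise \<open>M\<close> is
  the product of the absolute values of the roots in \<open>S\<close>, the set of the roots of modulus greater
  than \<open>1\<close>. The difference \<open>d = p - q\<close> is built up by steps \<open>d \<mapsto> \<eta> + X d\<close> with
  \<open>\<eta> \<in> {-2, 0, 2}\<close> of probabilities \<open>1/4, 1/2, 1/4\<close>. The proof exhibits a positive function
  \<open>F(d) = exp(-Q(d)/8)\<close> that depends only on the values of \<open>d\<close> on \<open>S\<close>, equals \<open>1\<close> when these vanish,
  and whose average over a step is at most \<open>\<rho> F(d)\<close>. The collision probability is then at most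
  \<open>\<rho>\<^sup>n\<close>, and the entropy rate at least \<open>- log \<rho>\<close>.

  The form \<open>Q\<close> comes from the model space of the Blaschke product with zeros \<open>1/s\<close> for \<open>s \<in> S\<close>: in
  this space the backward shift is a contraction whose defect has rank one, so that \<open>d \<mapsto> X d\<close>
  increases \<open>Q\<close> by exactly \<open>|t|\<^sup>2\<close> for a linear functional \<open>t\<close>. When \<open>Q\<close> is normalised by the
  reproducing kernel at \<open>0\<close>, the cross term of the step is \<open>2 \<eta> Re t\<close> with the same \<open>t\<close>, and the step
  \<open>\<eta>\<close> alone contributes \<open>\<eta>\<^sup>2 (1 - 1/M\<^sup>2)\<close> (\<open>exists_blaschke_weights\<close>, \<open>kernel_form_shift\<close>). Averaging over
  \<open>\<eta>\<close> turns the cross term into \<open>cosh(Re t / 2) \<le> exp((Re t)\<^sup>2/8)\<close>, which the gain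
  \<open>exp(-|t|\<^sup>2/8)\<close> absorbs (\<open>gaussian_average_le\<close>). This gives \<open>\<rho> = (1 + exp(-(1 - 1/M\<^sup>2)/2))/2\<close>, and
  \<open>- log \<rho>\<close> is comparable with \<open>min(1, log M)\<close>. Only algebraic identities for \<open>Q\<close> enter; the
  Hilbert space itself does not appear.
\<close>

section \<open>Irreducible integer polynomials and their complex roots\<close>

text \<open>
  This is Gauss's lemma in the form needed here, obtained without passing to the rationals. An integer
  polynomial \<open>g\<close> of least degree with root \<open>z\<close> divides a multiple \<open>c f\<close> of every other \<open>f\<close> with root \<open>z\<close>, by
  pseudo-division. Applied to \<open>p\<close>, which is prime, this shows that \<open>p\<close> itself has least degree, and
  then that \<open>p\<close> divides \<open>c q\<close>, hence \<open>q\<close>.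
\<close>

lemma irreducible_dvd_of_common_root:
  fixes p q :: "int poly" and z :: complex
  assumes irr: "irreducible p" and deg: "degree p > 0"
    and pz: "poly (of_int_poly p) z = 0" and qz: "poly (of_int_poly q) z = 0"
  shows "p dvd q"
proof -
  have prime: "prime_elem p"
    using irr by (rule irreducible_imp_prime_elem)
  have p0: "p \<noteq> 0" using deg by auto
  define P where "P g \<longleftrightarrow> g \<noteq> 0 \<and> poly (of_int_poly g) z = 0" for g :: "int poly"
  define g where "g = (ARG_MIN degree g. P g)"
  have "P p" using p0 pz by (simp add: P_def)
  hence Pg: "P g" and min: "\<And>h. P h \<Longrightarrow> degree g \<le> degree h"
    using arg_min_nat_lemma[of P p degree] by (auto simp: g_def)
  have division: "\<exists>c k. c \<noteq> 0 \<and> Polynomial.smult c f = h * k"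
    if h: "P h" and hmin: "degree h = degree g" and f: "poly (of_int_poly f) z = 0" for f h
  proof -
    obtain c k where ck: "c \<noteq> 0" "Polynomial.smult c f = h * k + pseudo_mod f h"
      using pseudo_mod(1)[of h f] h by (auto simp: P_def)
    have "of_int_poly (Polynomial.smult c f) = of_int_poly h * of_int_poly k + (of_int_poly (pseudo_mod f h) :: complex poly)"
      unfolding ck(2) by (simp add: of_int_poly_hom.hom_add of_int_poly_hom.hom_mult)
    hence "poly (of_int_poly (pseudo_mod f h)) z = 0"
      using h f by (simp add: P_def of_int_hom.map_poly_hom_smult)
        (metis add_cancel_left_left mult_eq_0_iff poly_add poly_mult poly_smult)
    moreover have "pseudo_mod f h = 0 \<or> degree (pseudo_mod f h) < degree g"
      using pseudo_mod(2)[of h f] h hmin by (auto simp: P_def)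
    ultimately have "pseudo_mod f h = 0"
      using min[of "pseudo_mod f h"] unfolding P_def by linarith
    with ck show ?thesis by auto
  qed
  have "p dvd g"
  proof -
    obtain c k where ck: "c \<noteq> 0" "Polynomial.smult c p = g * k"
      using division[OF Pg refl pz] by auto
    have "p dvd g * k" using ck(2) by (metis dvd_smult dvd_refl)
    hence "p dvd g \<or> p dvd k" using prime by (simp add: prime_elem_dvd_mult_iff)
    moreover have "\<not> p dvd k"
    proof
      assume "p dvd k"
      then obtain l where "k = p * l" by auto
      hence "p * [:c:] = p * (g * l)" using ck(2) by (simp add: mult_ac)
      hence cgl: "[:c:] = g * l" using p0 by (simp only: mult_cancel_left) simp
      hence "degree g + degree l = 0"
        using ck(1) degree_mult_eq[of g l] by (metis degree_pCons_0 mult_zero_left mult_zero_right pCons_eq_0_iff)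
      hence "degree g = 0" by simp
      then obtain e where "g = [:e:]" by (rule degree_eq_zeroE)
      thus False using Pg by (auto simp: P_def)
    qed
    ultimately show ?thesis by blast
  qed
  hence "degree p = degree g"
    using min[OF \<open>P p\<close>] Pg dvd_imp_degree_le[of p g] by (auto simp: P_def)
  then obtain c k where ck: "c \<noteq> 0" "Polynomial.smult c q = p * k"
    using division[OF \<open>P p\<close> _ qz] by auto
  hence "p dvd [:c:] * q" by auto
  hence "p dvd [:c:] \<or> p dvd q" using prime by (simp only: prime_elem_dvd_mult_iff)
  moreover have "\<not> p dvd [:c:]"
    using dvd_imp_degree_le[of p "[:c:]"] deg ck(1) by auto
  ultimately show ?thesis by blast
qed

lemma irreducible_root_imp_degree_pos:
  fixes p :: "int poly" and z :: complex
  assumes "irreducible p" "poly (of_int_poly p) z = 0"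
  shows "degree p > 0"
proof (rule ccontr)
  assume "\<not> ?thesis"
  then obtain c where "p = [:c:]" by (auto elim: degree_eq_zeroE)
  thus False using assms by (cases "c = 0") (auto simp: map_poly_pCons)
qed

lemma int_minpoly:
  assumes "algebraic a"
  shows "irreducible (int_minpoly a)" "poly (of_int_poly (int_minpoly a)) a = 0"
proof -
  obtain q where q: "poly (of_int_poly q) a = 0" "q \<noteq> 0"
    using assms by (auto elim: algebraicE')
  have "\<exists>p. irreducible p \<and> poly (of_int_poly p) a = 0"
    using q(2,1)
  proof (induction q rule: prime_divisors_induct)
    case zero
    then show ?case by simp
  next
    case (unit x)
    then obtain c where "x = [:c:]" by (auto simp: is_unit_poly_iff)
    then show ?case using unit by auto
  next
    case (factor p x)
    show ?case
    proof (cases "poly (of_int_poly p) a = 0")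
      case True
      then show ?thesis using factor(1) prime_elem_imp_irreducible prime_def by blast
    next
      case False
      then show ?thesis using factor by (auto simp: of_int_poly_hom.hom_mult)
    qed
  qed
  hence "irreducible (int_minpoly a) \<and> poly (of_int_poly (int_minpoly a)) a = 0"
    unfolding int_minpoly_def by (rule someI_ex)
  thus "irreducible (int_minpoly a)" "poly (of_int_poly (int_minpoly a)) a = 0" by auto
qed

text \<open>
  The roots are simple because a double root would be shared with the derivative, whose degree is too
  small for it to be divisible by \<open>p\<close>. So products over the list of roots are products over the
  set of roots.
\<close>

lemma
  fixes p :: "int poly"
  assumes irr: "irreducible p" and deg: "degree p > 0"
  defines "R \<equiv> {z::complex. poly (of_int_poly p) z = 0}"
  shows irreducible_card_roots: "card R = degree p"
    and mahler_measure_irreducible: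
      "mahler_measure p = \<bar>of_int (lead_coeff p)\<bar> * (\<Prod>z\<in>R. max 1 (cmod z))"
proof -
  let ?p = "of_int_poly p :: complex poly"
  have p0: "p \<noteq> 0" using deg by auto
  have pd: "\<not> p dvd pderiv p"
  proof
    assume "p dvd pderiv p"
    moreover have "pderiv p \<noteq> 0" using deg by (simp add: pderiv_eq_0_iff)
    ultimately have "degree p \<le> degree (pderiv p)" by (rule dvd_imp_degree_le)
    thus False using deg by (simp add: degree_pderiv)
  qed
  have "rsquarefree ?p"
    unfolding rsquarefree_roots
  proof (intro allI notI)
    fix z assume "poly ?p z = 0 \<and> poly (pderiv ?p) z = 0"
    hence "p dvd pderiv p"
      using irreducible_dvd_of_common_root[OF irr deg, of z "pderiv p"]
      by (simp add: of_int_hom.map_poly_pderiv)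
    thus False using pd by simp
  qed
  hence eq: "?p = Polynomial.smult (lead_coeff ?p) (\<Prod>z\<in>R. [:-z, 1:])"
    unfolding R_def by (rule complex_poly_decompose_rsquarefree[symmetric])
  have fin: "finite R" unfolding R_def using p0 by (intro poly_roots_finite) simp
  have "degree ?p = degree (\<Prod>z\<in>R. [:-z, 1:] :: complex poly)"
    by (subst eq) (use p0 in simp)
  also have "\<dots> = (\<Sum>z\<in>R. degree [:-z, 1:])"
    by (rule degree_prod_eq_sum_degree) auto
  also have "\<dots> = card R" by simp
  finally show card: "card R = degree p" by simp
  define rs where "rs = complex_roots_complex ?p"
  have rs: "Polynomial.smult (lead_coeff ?p) (\<Prod>a\<leftarrow>rs. [:- a, 1:]) = ?p" "length rs = degree p"
    using complex_roots[of ?p] by (simp_all add: rs_def)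
  have "poly ?p z = 0 \<longleftrightarrow> z \<in> set rs" for z
    by (subst rs(1)[symmetric]) (use p0 in \<open>auto simp: poly_prod_list o_def prod_list_zero_iff\<close>)
  hence "set rs = R" by (auto simp: R_def)
  moreover from this have "distinct rs" using card rs(2) by (intro card_distinct) simp
  ultimately have "(\<Prod>a\<leftarrow>rs. max 1 (cmod a)) = (\<Prod>z\<in>R. max 1 (cmod z))"
    by (metis prod.distinct_set_conv_list)
  thus "mahler_measure p = \<bar>of_int (lead_coeff p)\<bar> * (\<Prod>z\<in>R. max 1 (cmod z))"
    unfolding mahler_measure_def mahler_measure_poly_def rs_def by simp
qed

section \<open>Shannon entropy of finitely supported distributions\<close>

lemma shannon_entropy_finite:
  assumes "finite (set_pmf p)"
  shows "shannon_entropy p = (\<Sum>x\<in>set_pmf p. pmf p x * - log 2 (pmf p x))"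
  using assms by (simp add: shannon_entropy_def infsum_finite sum_negf)

lemma sum_pmf_mult_map_pmf:
  fixes f :: "'b \<Rightarrow> real"
  assumes "finite (set_pmf p)"
  shows "(\<Sum>y\<in>set_pmf (map_pmf g p). pmf (map_pmf g p) y * f y) = (\<Sum>x\<in>set_pmf p. pmf p x * f (g x))"
proof -
  have "measure_pmf.expectation (map_pmf g p) f = (\<Sum>y\<in>set_pmf (map_pmf g p). pmf (map_pmf g p) y * f y)"
    using assms by (subst integral_measure_pmf_real[where A="set_pmf (map_pmf g p)"]) (auto simp: mult.commute)
  moreover have "measure_pmf.expectation p (\<lambda>x. f (g x)) = (\<Sum>x\<in>set_pmf p. pmf p x * f (g x))"
    using assms by (subst integral_measure_pmf_real[where A="set_pmf p"]) (auto simp: mult.commute)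
  ultimately show ?thesis by simp
qed

lemma pmf_le_pmf_map: "pmf p x \<le> pmf (map_pmf g p) (g x)"
proof -
  have "pmf p x = measure (measure_pmf p) {x}" by (simp add: pmf.rep_eq)
  also have "\<dots> \<le> measure (measure_pmf p) (g -` {g x})"
    by (rule measure_pmf.finite_measure_mono) auto
  finally show ?thesis by (simp add: pmf_map)
qed

text \<open>
  Applying a function can only merge atoms, so every point sits in an atom of larger mass.
\<close>

lemma shannon_entropy_map_le:
  assumes fin: "finite (set_pmf p)"
  shows "shannon_entropy (map_pmf g p) \<le> shannon_entropy p"
proof -
  have "shannon_entropy (map_pmf g p) =
      (\<Sum>x\<in>set_pmf p. pmf p x * - log 2 (pmf (map_pmf g p) (g x)))"
    using sum_pmf_mult_map_pmf[OF fin, of g "\<lambda>y. - log 2 (pmf (map_pmf g p) y)"] fin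
    by (simp only: shannon_entropy_finite set_map_pmf finite_imageI)
  also have "\<dots> \<le> (\<Sum>x\<in>set_pmf p. pmf p x * - log 2 (pmf p x))"
  proof (intro sum_mono mult_left_mono)
    fix x assume "x \<in> set_pmf p"
    hence "0 < pmf p x" by (simp add: pmf_positive_iff)
    thus "- log 2 (pmf (map_pmf g p) (g x)) \<le> - log 2 (pmf p x)"
      using pmf_le_pmf_map[of p x g] by simp
  qed auto
  also have "\<dots> = shannon_entropy p" using fin by (simp add: shannon_entropy_finite)
  finally show ?thesis .
qed

lemma shannon_entropy_pair:
  assumes p: "finite (set_pmf p)" and q: "finite (set_pmf q)"
  shows "shannon_entropy (pair_pmf p q) = shannon_entropy p + shannon_entropy q"
proof -
  let ?h = "\<lambda>r x. - log 2 (pmf r x)"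
  have "shannon_entropy (pair_pmf p q) =
      (\<Sum>(x, y)\<in>set_pmf p \<times> set_pmf q. pmf p x * pmf q y * ?h (pair_pmf p q) (x, y))"
    using p q by (subst shannon_entropy_finite) (auto simp: pmf_pair intro!: sum.cong)
  also have "\<dots> = (\<Sum>(x, y)\<in>set_pmf p \<times> set_pmf q.
      pmf q y * (pmf p x * ?h p x) + pmf p x * (pmf q y * ?h q y))"
    by (intro sum.cong) (auto simp: pmf_pair log_mult pmf_positive_iff[symmetric] algebra_simps dest!: iffD1[OF set_pmf_iff])
  also have "\<dots> = (\<Sum>y\<in>set_pmf q. pmf q y) * (\<Sum>x\<in>set_pmf p. pmf p x * ?h p x)
      + (\<Sum>x\<in>set_pmf p. pmf p x) * (\<Sum>y\<in>set_pmf q. pmf q y * ?h q y)"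
    unfolding sum.cartesian_product[symmetric] sum.distrib sum_distrib_left[symmetric] sum_distrib_right[symmetric] by simp
  also have "\<dots> = shannon_entropy p + shannon_entropy q"
    using p q by (simp add: shannon_entropy_finite sum_pmf_eq_1)
  finally show ?thesis .
qed

lemma log2_le_linear:
  assumes "0 < (x::real)"
  shows "log 2 x \<le> (x - 1) / ln 2"
  using ln_le_minus_one[OF assms] by (simp add: log_def divide_right_mono)

text \<open>
  Jensen's inequality for the logarithm; the bounds by the size of the support and by the collision
  probability are instances of it.
\<close>

lemma sum_pmf_log_le:
  assumes fin: "finite (set_pmf p)" and w: "\<And>x. x \<in> set_pmf p \<Longrightarrow> w x > (0::real)"
    and le: "(\<Sum>x\<in>set_pmf p. pmf p x * w x) \<le> b"
  shows "(\<Sum>x\<in>set_pmf p. pmf p x * log 2 (w x)) \<le> log 2 b"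
proof -
  obtain x where x: "x \<in> set_pmf p" using set_pmf_not_empty[of p] by blast
  have "0 < (\<Sum>x\<in>set_pmf p. pmf p x * w x)"
    using fin x w by (intro sum_pos2[of _ x]) (auto simp: pmf_positive less_imp_le)
  hence b: "b > 0" using le by simp
  have one: "(\<Sum>x\<in>set_pmf p. pmf p x) = 1" using fin by (simp add: sum_pmf_eq_1)
  have "(\<Sum>x\<in>set_pmf p. pmf p x * log 2 (w x)) - log 2 b =
     (\<Sum>x\<in>set_pmf p. pmf p x * log 2 (w x)) - (\<Sum>x\<in>set_pmf p. pmf p x) * log 2 b"
    by (simp add: one)
  also have "\<dots> = (\<Sum>x\<in>set_pmf p. pmf p x * log 2 (w x / b))"
    unfolding sum_distrib_right sum_subtractf[symmetric] using w b
    by (intro sum.cong) (auto simp: log_divide algebra_simps dest: w)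
  also have "\<dots> \<le> (\<Sum>x\<in>set_pmf p. pmf p x * ((w x / b - 1) / ln 2))"
    using w b by (intro sum_mono mult_left_mono log2_le_linear) auto
  also have "\<dots> = ((\<Sum>x\<in>set_pmf p. pmf p x * w x) / b - (\<Sum>x\<in>set_pmf p. pmf p x)) / ln 2"
    unfolding sum_divide_distrib sum_subtractf[symmetric] by (intro sum.cong) (auto simp: field_simps)
  also have "\<dots> \<le> 0" using le b by (simp add: one divide_le_0_iff)
  finally show ?thesis by simp
qed

lemma shannon_entropy_le_log_card:
  assumes fin: "finite (set_pmf p)"
  shows "shannon_entropy p \<le> log 2 (card (set_pmf p))"
proof -
  have "(\<Sum>x\<in>set_pmf p. pmf p x * log 2 (1 / pmf p x)) \<le> log 2 (card (set_pmf p))"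
    by (rule sum_pmf_log_le[OF fin]) (auto simp: pmf_positive set_pmf_iff)
  moreover have "(\<Sum>x\<in>set_pmf p. pmf p x * log 2 (1 / pmf p x)) = shannon_entropy p"
    unfolding shannon_entropy_finite[OF fin]
    by (intro sum.cong) (simp_all add: log_divide pmf_positive)
  ultimately show ?thesis by simp
qed

text \<open>
  The sum of squares is the probability that two independent samples agree.
\<close>

lemma shannon_entropy_ge_collision:
  assumes fin: "finite (set_pmf p)" and le: "(\<Sum>x\<in>set_pmf p. (pmf p x)\<^sup>2) \<le> b"
  shows "- log 2 b \<le> shannon_entropy p"
  using sum_pmf_log_le[OF fin, of "pmf p" b] le
  by (simp add: shannon_entropy_finite[OF fin] power2_eq_square pmf_positive sum_negf)

lemma shannon_entropy_nonneg:
  assumes fin: "finite (set_pmf p)"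
  shows "0 \<le> shannon_entropy p"
  unfolding shannon_entropy_finite[OF fin]
  by (intro sum_nonneg mult_nonneg_nonneg) (auto simp: pmf_le_1 pmf_positive)

section \<open>Convergence of subadditive sequences\<close>

text \<open>
  Fekete's lemma: the quotients converge to their infimum.
\<close>

lemma fekete_convergent:
  fixes f :: "nat \<Rightarrow> real"
  assumes sub: "\<And>m n. f (m + n) \<le> f m + f n" and nonneg: "\<And>n. 0 \<le> f n"
  shows "convergent (\<lambda>n. f n / real n)"
proof -
  define L where "L = Inf ((\<lambda>n. f n / real n) ` {1..})"
  have bdd: "bdd_below ((\<lambda>n. f n / real n) ` {1..})"
    by (rule bdd_belowI[of _ 0]) (auto simp: nonneg)
  have L_le: "L \<le> f n / real n" if "n \<ge> 1" for n
    unfolding L_def using that by (intro cInf_lower bdd) auto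
  have mult: "f (q * m + r) \<le> real q * f m + f r" for q m r
  proof (induction q)
    case (Suc q)
    have "f (Suc q * m + r) \<le> f m + f (q * m + r)"
      using sub[of m "q * m + r"] by (simp add: algebra_simps)
    with Suc show ?case by (simp add: algebra_simps)
  qed simp
  have "(\<lambda>n. f n / real n) \<longlonglongrightarrow> L"
  proof (rule LIMSEQ_I)
    fix e :: real assume e: "e > 0"
    obtain m where m: "m \<ge> 1" "f m / real m < L + e / 2"
      using cInf_lessD[of "(\<lambda>n. f n / real n) ` {1..}" "L + e / 2"] e unfolding L_def by auto
    \<comment> \<open>a bound for \<open>f\<close> on all remainders modulo \<open>m\<close>\<close>
    define C where "C = (\<Sum>r<m. f r)"
    have C: "f r \<le> C" if "r < m" for r
      unfolding C_def using that nonneg by (intro member_le_sum) auto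
    obtain N :: nat where N: "C / (e / 2) < real N" using reals_Archimedean2 by blast
    show "\<exists>N. \<forall>n\<ge>N. norm (f n / real n - L) < e"
    proof (intro exI allI impI)
      fix n assume n: "n \<ge> max 1 N"
      have "f n \<le> real (n div m) * f m + f (n mod m)"
        using mult[of "n div m" m "n mod m"] by simp
      also have "\<dots> \<le> real n / real m * f m + C"
        using m nonneg C[of "n mod m"] by (intro add_mono mult_right_mono of_nat_div_le_of_nat) auto
      finally have "f n / real n \<le> (real n / real m * f m + C) / real n"
        by (rule divide_right_mono) simp
      also have "\<dots> = f m / real m + C / real n"
        using n m by (simp add: add_divide_distrib)
      also have "C / real n < e / 2"
      proof -
        have "C / (e / 2) < real n" using N n by linarith
        hence "C < real n * (e / 2)" using e by (simp add: pos_divide_less_eq)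
        thus ?thesis using n by (simp add: pos_divide_less_eq mult.commute)
      qed
      finally have "f n / real n < L + e" using m by linarith
      moreover have "L \<le> f n / real n" using n by (intro L_le) auto
      ultimately show "norm (f n / real n - L) < e" by simp
    qed
  qed
  thus ?thesis by (rule convergentI)
qed

section \<open>Random sums as values of polynomials with coefficients 1 and -1\<close>

definition sign_polys :: "nat \<Rightarrow> int poly set" where
  "sign_polys n = {p. (\<forall>i<n. poly.coeff p i \<in> {1, -1}) \<and> (\<forall>i\<ge>n. poly.coeff p i = 0)}"

lemma bij_betw_sign_polys_PiE_dflt:
  "bij_betw (\<lambda>p i. of_int (poly.coeff p i)) (sign_polys n) (PiE_dflt {..<n} 0 (\<lambda>_. {1, -1::complex}))"
  unfolding bij_betw_def
proof (intro conjI equalityI subsetI)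
  show "inj_on (\<lambda>p i. of_int (poly.coeff p i) :: complex) (sign_polys n)"
    by (auto simp: inj_on_def fun_eq_iff poly_eq_iff)
next
  fix \<xi> :: "nat \<Rightarrow> complex" assume \<xi>: "\<xi> \<in> PiE_dflt {..<n} 0 (\<lambda>_. {1, -1})"
  define p where "p = (\<Sum>i<n. Polynomial.monom (if \<xi> i = 1 then 1 else -1 :: int) i)"
  have c: "poly.coeff p j = (if j < n then if \<xi> j = 1 then 1 else -1 else 0)" for j
    by (simp add: p_def coeff_sum)
  have "p \<in> sign_polys n" by (auto simp: sign_polys_def c)
  moreover have "(\<lambda>i. of_int (poly.coeff p i)) = \<xi>"
    using \<xi> by (fastforce simp: fun_eq_iff c PiE_dflt_def)
  ultimately show "\<xi> \<in> (\<lambda>p i. of_int (poly.coeff p i)) ` sign_polys n" by (metis imageI)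
qed (auto simp: sign_polys_def PiE_dflt_def)

lemma finite_sign_polys: "finite (sign_polys n)"
  using bij_betw_finite[OF bij_betw_sign_polys_PiE_dflt[of n]] by (simp add: finite_PiE_dflt)

lemma card_sign_polys: "card (sign_polys n) = 2 ^ n"
proof -
  have "card {1, -1 :: complex} = 2" by simp
  thus ?thesis
    using bij_betw_same_card[OF bij_betw_sign_polys_PiE_dflt[of n]] by (simp add: card_PiE_dflt numeral_2_eq_2)
qed

lemma sign_polys_nonempty: "sign_polys n \<noteq> {}"
  using card_sign_polys[of n] by auto

lemma poly_sign_poly:
  assumes "p \<in> sign_polys n"
  shows "poly (of_int_poly p) (a::complex) = (\<Sum>i<n. of_int (poly.coeff p i) * a ^ i)"
proof (rule poly_as_sum_of_monoms'[of "of_int_poly p" "n - 1", symmetric, THEN arg_cong[of _ _ "\<lambda>p. poly p a"], THEN trans])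
  show "degree (of_int_poly p :: complex poly) \<le> n - 1"
    using assms by (intro degree_le) (auto simp: sign_polys_def)
  show "poly (\<Sum>i\<le>n - 1. Polynomial.monom (poly.coeff (of_int_poly p) i) i) a = (\<Sum>i<n. of_int (poly.coeff p i) * a ^ i)"
    using assms by (cases n) (auto simp: poly_sum poly_monom sign_polys_def lessThan_Suc_atMost)
qed

lemma bernoulli_sum_pmf_eq_sign_polys:
  "bernoulli_sum_pmf a n = map_pmf (\<lambda>p. poly (of_int_poly p) a) (pmf_of_set (sign_polys n))"
proof -
  have "Pi_pmf {..<n} 0 (\<lambda>_. pmf_of_set {1, -1::complex}) = pmf_of_set (PiE_dflt {..<n} 0 (\<lambda>_. {1, -1}))"
    by (rule Pi_pmf_of_set) auto
  also have "\<dots> = map_pmf (\<lambda>p i. of_int (poly.coeff p i)) (pmf_of_set (sign_polys n))"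
    by (rule map_pmf_of_set_bij_betw[symmetric])
      (auto intro: bij_betw_sign_polys_PiE_dflt finite_sign_polys simp: sign_polys_nonempty)
  finally have "bernoulli_sum_pmf a n =
      map_pmf (\<lambda>p. \<Sum>i<n. of_int (poly.coeff p i) * a ^ i) (pmf_of_set (sign_polys n))"
    by (simp add: bernoulli_sum_pmf_def map_pmf_comp)
  also have "\<dots> = map_pmf (\<lambda>p. poly (of_int_poly p) a) (pmf_of_set (sign_polys n))"
    by (intro map_pmf_cong refl) (simp add: poly_sign_poly set_pmf_of_set finite_sign_polys sign_polys_nonempty)
  finally show ?thesis .
qed

lemma bij_betw_sign_polys_add:
  "bij_betw (\<lambda>(p, q). p + Polynomial.monom 1 m * q) (sign_polys m \<times> sign_polys n) (sign_polys (m + n))"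
  unfolding bij_betw_def
proof (intro conjI equalityI subsetI)
  have c: "poly.coeff (p + Polynomial.monom 1 m * q) i = (if i < m then poly.coeff p i else poly.coeff q (i - m))"
    if "p \<in> sign_polys m" for p q i
    using that by (auto simp: coeff_monom_mult sign_polys_def)
  show "inj_on (\<lambda>(p, q). p + Polynomial.monom 1 m * q) (sign_polys m \<times> sign_polys n)"
  proof (intro inj_onI, clarify)
    fix p q p' q' assume *: "p \<in> sign_polys m" "p' \<in> sign_polys m"
      and eq: "p + Polynomial.monom 1 m * q = p' + Polynomial.monom 1 m * q'"
    have **: "(if i < m then poly.coeff p i else poly.coeff q (i - m)) =
        (if i < m then poly.coeff p' i else poly.coeff q' (i - m))" for i
      using arg_cong[OF eq, of "\<lambda>r. poly.coeff r i"] by (simp only: c[OF *(1)] c[OF *(2)])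
    have "poly.coeff p i = poly.coeff p' i" for i
      using **[of i] * by (cases "i < m") (auto simp: sign_polys_def)
    moreover have "poly.coeff q i = poly.coeff q' i" for i
      using **[of "i + m"] by simp
    ultimately show "p = p' \<and> q = q'" by (simp add: poly_eq_iff)
  qed
  show "r \<in> sign_polys (m + n)"
    if r: "r \<in> (\<lambda>(p, q). p + Polynomial.monom 1 m * q) ` (sign_polys m \<times> sign_polys n)" for r
  proof -
    obtain p q where r: "r = p + Polynomial.monom 1 m * q" and p: "p \<in> sign_polys m" and q: "q \<in> sign_polys n"
      using r by auto
    show ?thesis
      unfolding sign_polys_def r mem_Collect_eq c[OF p] using p q by (auto simp: sign_polys_def)
  qed
  show "r \<in> (\<lambda>(p, q). p + Polynomial.monom 1 m * q) ` (sign_polys m \<times> sign_polys n)"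
    if "r \<in> sign_polys (m + n)" for r
  proof (rule image_eqI[of _ _ "(poly_cutoff m r, poly_shift m r)"])
    have p: "poly_cutoff m r \<in> sign_polys m"
      using that by (auto simp: sign_polys_def coeff_poly_cutoff)
    moreover have "poly_shift m r \<in> sign_polys n"
      using that by (auto simp: sign_polys_def coeff_poly_shift)
    ultimately show "(poly_cutoff m r, poly_shift m r) \<in> sign_polys m \<times> sign_polys n" by simp
    show "r = (case (poly_cutoff m r, poly_shift m r) of (p, q) \<Rightarrow> p + Polynomial.monom 1 m * q)"
      unfolding prod.case poly_eq_iff c[OF p] by (auto simp: coeff_poly_cutoff coeff_poly_shift)
  qed
qed

text \<open>
  The first \<open>m\<close> signs and the remaining \<open>n\<close> signs are independent; the latter contribute a copy of the
  shorter sum, scaled by \<open>a\<^sup>m\<close>.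
\<close>

lemma bernoulli_sum_pmf_add:
  "bernoulli_sum_pmf a (m + n) =
     map_pmf (\<lambda>(x, y). x + a ^ m * y) (pair_pmf (bernoulli_sum_pmf a m) (bernoulli_sum_pmf a n))"
proof -
  have "pmf_of_set (sign_polys (m + n)) =
      map_pmf (\<lambda>(p, q). p + Polynomial.monom 1 m * q) (pmf_of_set (sign_polys m \<times> sign_polys n))"
    using bij_betw_sign_polys_add by (rule map_pmf_of_set_bij_betw[symmetric])
      (auto simp: finite_sign_polys sign_polys_nonempty)
  also have "pmf_of_set (sign_polys m \<times> sign_polys n) =
      pair_pmf (pmf_of_set (sign_polys m)) (pmf_of_set (sign_polys n))"
    by (intro pmf_eqI) (auto simp: pmf_pair finite_sign_polys sign_polys_nonempty pmf_of_set indicator_def card_cartesian_product)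
  finally show ?thesis
    by (simp add: bernoulli_sum_pmf_eq_sign_polys map_pmf_comp map_pair[symmetric] case_prod_unfold
        of_int_poly_hom.hom_add of_int_poly_hom.hom_mult poly_monom)
qed

lemma bij_betw_sign_polys_pCons:
  "bij_betw (\<lambda>(s, p). pCons s p) ({1, -1} \<times> sign_polys n) (sign_polys (Suc n))"
  unfolding bij_betw_def
proof (intro conjI equalityI subsetI)
  show "r \<in> (\<lambda>(s, p). pCons s p) ` ({1, -1} \<times> sign_polys n)" if r: "r \<in> sign_polys (Suc n)" for r
  proof (cases r)
    case (pCons s p)
    have "poly.coeff r 0 = s" "\<And>i. poly.coeff r (Suc i) = poly.coeff p i" by (simp_all add: pCons)
    hence "s \<in> {1, -1}" "p \<in> sign_polys n"
      using r unfolding sign_polys_def by (force, fastforce)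
    thus ?thesis unfolding pCons by force
  qed
qed (auto simp: inj_on_def sign_polys_def coeff_pCons split: nat.splits)

lemma sum_sign_polys_Suc:
  fixes f :: "int poly \<Rightarrow> real"
  shows "(\<Sum>p\<in>sign_polys (Suc n). f p) = (\<Sum>p\<in>sign_polys n. f (pCons 1 p) + f (pCons (-1) p))"
proof -
  have "(\<Sum>p\<in>sign_polys (Suc n). f p) = (\<Sum>(s, p)\<in>{1, -1} \<times> sign_polys n. f (pCons s p))"
    by (subst sum.reindex_bij_betw[OF bij_betw_sign_polys_pCons, symmetric]) (simp add: case_prod_unfold)
  thus ?thesis by (simp add: sum.cartesian_product[symmetric] sum.distrib)
qed

lemma sign_polys_0: "sign_polys 0 = {0}"
  by (auto simp: sign_polys_def poly_eq_iff)

text \<open>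
  A supermartingale argument. Prepending independent signs to \<open>p\<close> and \<open>q\<close> turns the difference
  \<open>d = p - q\<close> into \<open>\<eta> + X d\<close>, where \<open>\<eta>\<close> is \<open>2, 0, -2\<close> for \<open>1, 2, 1\<close> of the four choices of signs.
\<close>

lemma sum_sign_polys_diff_le:
  fixes F :: "int poly \<Rightarrow> real"
  assumes step: "\<And>d. F (pCons 2 d) + 2 * F (pCons 0 d) + F (pCons (-2) d) \<le> 4 * \<rho> * F d"
    and \<rho>: "\<rho> \<ge> 0"
  shows "(\<Sum>p\<in>sign_polys n. \<Sum>q\<in>sign_polys n. F (p - q)) \<le> (4 * \<rho>) ^ n * F 0"
proof (induction n)
  case 0
  then show ?case by (simp add: sign_polys_0)
next
  case (Suc n)
  have "(\<Sum>p\<in>sign_polys (Suc n). \<Sum>q\<in>sign_polys (Suc n). F (p - q)) =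
      (\<Sum>p\<in>sign_polys n. \<Sum>q\<in>sign_polys n.
         F (pCons 2 (p - q)) + 2 * F (pCons 0 (p - q)) + F (pCons (-2) (p - q)))"
    by (simp add: sum_sign_polys_Suc sum.distrib sum_distrib_left algebra_simps)
  also have "\<dots> \<le> (\<Sum>p\<in>sign_polys n. \<Sum>q\<in>sign_polys n. 4 * \<rho> * F (p - q))"
    by (intro sum_mono step)
  also have "\<dots> = 4 * \<rho> * (\<Sum>p\<in>sign_polys n. \<Sum>q\<in>sign_polys n. F (p - q))"
    by (simp add: sum_distrib_left)
  also have "\<dots> \<le> 4 * \<rho> * ((4 * \<rho>) ^ n * F 0)"
    using Suc \<rho> by (intro mult_left_mono) auto
  finally show ?case by (simp add: mult_ac)
qed


text \<open>
  The collision probability of the random sum, as a count of pairs of sign sequences whose difference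
  has the root \<open>a\<close>.
\<close>

lemma sum_pmf_square_bernoulli_sum:
  "(\<Sum>x\<in>set_pmf (bernoulli_sum_pmf a n). (pmf (bernoulli_sum_pmf a n) x)\<^sup>2) =
     (\<Sum>p\<in>sign_polys n. \<Sum>q\<in>sign_polys n. of_bool (poly (of_int_poly (p - q)) a = 0)) / 4 ^ n"
proof -
  let ?ev = "\<lambda>p. poly (of_int_poly p) a" and ?S = "sign_polys n" and ?B = "bernoulli_sum_pmf a n"
  note [simp] = finite_sign_polys sign_polys_nonempty
  have pmf_B: "pmf ?B x = (\<Sum>q\<in>?S. of_bool (x = ?ev q)) / 2 ^ n" for x
  proof -
    have "pmf ?B x = real (card (?S \<inter> ?ev -` {x})) / 2 ^ n"
      by (simp add: bernoulli_sum_pmf_eq_sign_polys pmf_map measure_pmf_of_set card_sign_polys)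
    also have "?S \<inter> ?ev -` {x} = {q\<in>?S. x = ?ev q}" by auto
    finally show ?thesis by (simp add: sum.inter_filter[symmetric] of_bool_def)
  qed
  have "(\<Sum>x\<in>set_pmf ?B. (pmf ?B x)\<^sup>2) = (\<Sum>x\<in>set_pmf ?B. pmf ?B x * pmf ?B x)"
    by (simp add: power2_eq_square)
  also have "\<dots> = (\<Sum>p\<in>?S. 1 / 2 ^ n * pmf ?B (?ev p))"
    using sum_pmf_mult_map_pmf[of "pmf_of_set ?S" ?ev "pmf ?B"]
    by (simp add: bernoulli_sum_pmf_eq_sign_polys[symmetric] card_sign_polys)
  also have "\<dots> = (\<Sum>p\<in>?S. \<Sum>q\<in>?S. of_bool (?ev p = ?ev q)) / 4 ^ n"
    by (simp add: pmf_B sum_divide_distrib power_mult_distrib[symmetric])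
  finally show ?thesis by (simp add: of_int_poly_hom.hom_minus)
qed

lemma finite_set_bernoulli_sum: "finite (set_pmf (bernoulli_sum_pmf a n))"
  by (simp add: bernoulli_sum_pmf_eq_sign_polys finite_sign_polys sign_polys_nonempty)

lemma shannon_entropy_ge_of_collisions:
  assumes le: "(\<Sum>p\<in>sign_polys n. \<Sum>q\<in>sign_polys n. of_bool (poly (of_int_poly (p - q)) a = 0)) \<le> (4 * \<rho>) ^ n"
    and \<rho>: "\<rho> > 0"
  shows "n * - log 2 \<rho> \<le> shannon_entropy (bernoulli_sum_pmf a n)"
proof -
  have "- log 2 (\<rho> ^ n) \<le> shannon_entropy (bernoulli_sum_pmf a n)"
  proof (rule shannon_entropy_ge_collision[OF finite_set_bernoulli_sum])
    show "(\<Sum>x\<in>set_pmf (bernoulli_sum_pmf a n). (pmf (bernoulli_sum_pmf a n) x)\<^sup>2) \<le> \<rho> ^ n"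
      unfolding sum_pmf_square_bernoulli_sum using le by (simp add: divide_le_eq power_mult_distrib mult.commute)
  qed
  thus ?thesis using \<rho> by (simp add: log_nat_power)
qed

lemma bernoulli_entropy_LIMSEQ:
  "(\<lambda>n. shannon_entropy (bernoulli_sum_pmf a n) / n) \<longlonglongrightarrow> bernoulli_entropy a"
proof -
  have "convergent (\<lambda>n. shannon_entropy (bernoulli_sum_pmf a n) / n)"
  proof (rule fekete_convergent)
    fix m n
    show "shannon_entropy (bernoulli_sum_pmf a (m + n)) \<le>
        shannon_entropy (bernoulli_sum_pmf a m) + shannon_entropy (bernoulli_sum_pmf a n)"
      unfolding bernoulli_sum_pmf_add
      by (rule order_trans[OF shannon_entropy_map_le])
        (simp_all add: finite_set_bernoulli_sum shannon_entropy_pair)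
  qed (simp add: shannon_entropy_nonneg finite_set_bernoulli_sum)
  thus ?thesis unfolding bernoulli_entropy_def by (simp add: convergent_LIMSEQ_iff)
qed

lemma bernoulli_entropy_ge_of_collisions:
  assumes le: "\<And>n. (\<Sum>p\<in>sign_polys n. \<Sum>q\<in>sign_polys n. of_bool (poly (of_int_poly (p - q)) a = 0)) \<le> (4 * \<rho>) ^ n"
    and \<rho>: "\<rho> > 0"
  shows "- log 2 \<rho> \<le> bernoulli_entropy a"
proof (rule LIMSEQ_le_const[OF bernoulli_entropy_LIMSEQ], intro exI allI impI)
  fix n :: nat assume "n \<ge> 1"
  thus "- log 2 \<rho> \<le> shannon_entropy (bernoulli_sum_pmf a n) / n"
    using shannon_entropy_ge_of_collisions[OF le \<rho>, of n] by (simp add: pos_le_divide_eq mult.commute)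
qed

lemma bernoulli_entropy_le_1: "bernoulli_entropy a \<le> 1"
proof (rule LIMSEQ_le_const2[OF bernoulli_entropy_LIMSEQ], intro exI allI impI)
  fix n :: nat assume n: "n \<ge> 1"
  have "card (set_pmf (bernoulli_sum_pmf a n)) \<le> 2 ^ n"
    using card_image_le[OF finite_sign_polys[of n], of "\<lambda>p. poly (of_int_poly p) a"]
    by (simp add: bernoulli_sum_pmf_eq_sign_polys finite_sign_polys sign_polys_nonempty card_sign_polys)
  hence "log 2 (card (set_pmf (bernoulli_sum_pmf a n))) \<le> log 2 (2 ^ n)"
    using finite_set_bernoulli_sum[of a n] set_pmf_not_empty[of "bernoulli_sum_pmf a n"]
    by (intro log_mono) (auto simp: card_gt_0_iff numeral_power_le_of_nat_cancel_iff of_nat_le_numeral_power_cancel_iff)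
  hence "shannon_entropy (bernoulli_sum_pmf a n) \<le> n"
    using shannon_entropy_le_log_card[OF finite_set_bernoulli_sum[of a n]] by (simp add: log_nat_power)
  thus "shannon_entropy (bernoulli_sum_pmf a n) / n \<le> 1" using n by (simp add: pos_divide_le_eq)
qed


section \<open>A Hermitian form with a rank-one defect\<close>

definition lagrange_basis :: "complex set \<Rightarrow> complex \<Rightarrow> complex poly" where
  "lagrange_basis S s = Polynomial.smult (1 / (\<Prod>t\<in>S - {s}. s - t)) (\<Prod>t\<in>S - {s}. [:-t, 1:])"

lemma poly_lagrange_basis:
  "poly (lagrange_basis S s) z = (\<Prod>t\<in>S - {s}. z - t) / (\<Prod>t\<in>S - {s}. s - t)"
  by (simp add: lagrange_basis_def poly_prod)

text \<open>
  A polynomial is determined linearly by its values at more points than its degree. This is used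
  twice: to solve for the weights of the Hermitian form, and to bound the coefficients of a polynomial
  by its values.
\<close>

lemma lagrange_interpolation:
  assumes fin: "finite S" and deg: "degree P < card S"
  shows "P = (\<Sum>s\<in>S. Polynomial.smult (poly P s) (lagrange_basis S s))"
proof (rule poly_eqI_degree[of S])
  fix x assume x: "x \<in> S"
  have "poly (lagrange_basis S s) x = (if s = x then 1 else 0)" if "s \<in> S" for s
    using fin x that by (auto simp: poly_lagrange_basis prod_zero_iff)
  hence "(\<Sum>s\<in>S. poly P s * poly (lagrange_basis S s) x) = (\<Sum>s\<in>S. if s = x then poly P s else 0)"
    by (intro sum.cong) auto
  thus "poly P x = poly (\<Sum>s\<in>S. Polynomial.smult (poly P s) (lagrange_basis S s)) x"
    using fin x by (simp add: poly_sum)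
next
  have "degree (lagrange_basis S s) \<le> card S - 1" if "s \<in> S" for s
  proof -
    have "degree (lagrange_basis S s) \<le> degree (\<Prod>t\<in>S - {s}. [:-t, 1:])"
      unfolding lagrange_basis_def by (rule degree_smult_le)
    also have "\<dots> \<le> (\<Sum>t\<in>S - {s}. degree [:-t, 1:])"
      by (intro eq_refl degree_prod_eq_sum_degree) auto
    also have "\<dots> = card S - 1" using fin that by simp
    finally show ?thesis .
  qed
  hence "degree (\<Sum>s\<in>S. Polynomial.smult (poly P s) (lagrange_basis S s)) \<le> card S - 1"
    using fin by (intro degree_sum_le) (auto intro: order_trans[OF degree_smult_le])
  thus "degree (\<Sum>s\<in>S. Polynomial.smult (poly P s) (lagrange_basis S s)) < card S"
    using deg by linarith
qed (fact deg)

lemma mult_cnj_neq_1: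
  assumes "cmod i > 1" "cmod j > 1"
  shows "i * cnj j \<noteq> 1"
proof
  assume "i * cnj j = 1"
  hence "cmod i * cmod j = 1" by (metis complex_mod_cnj norm_mult norm_one)
  moreover have "1 * 1 < cmod i * cmod j" using assms by (intro mult_strict_mono) auto
  ultimately show False by simp
qed

lemma lagrange_term_eq:
  fixes z s d p X :: complex
  assumes "z \<noteq> s" "s \<noteq> 0" "d \<noteq> 0"
  shows "p * (X / d) = (z - s) * X * (- p / (d * s) * (s / (s - z)))"
proof -
  have "s / (s - z) = - (s / (z - s))" by (metis minus_diff_eq minus_divide_right)
  thus ?thesis using assms by simp
qed

lemma shifted_geometric_term:
  fixes s w :: complex
  assumes "w \<noteq> 0"
  shows "s / (s - 1 / w) = s * w / (s * w - 1)"
proof -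
  have "s * w - 1 = (s - 1 / w) * w" using assms by (simp add: left_diff_distrib)
  thus ?thesis using assms by simp
qed

text \<open>
  The weights \<open>c\<close> are the coefficients of the reproducing kernel at \<open>0\<close> of the model space, expressed
  in the basis of geometric sequences \<open>k \<mapsto> 1/j\<^sup>k\<close>: the first equation says that pairing with it evaluates
  each of them at \<open>k = 0\<close>. As a function of \<open>z = 1 / cnj i\<close> the sum is
  \<open>\<Sum>j. c j * j / (j - z)\<close>, a rational function with poles in \<open>S\<close>. It must be \<open>1\<close> at the points
  \<open>1 / cnj i\<close> and should vanish at infinity, so it is \<open>1 - N/E\<close> where \<open>E\<close> and \<open>N\<close> are the monic polynomials
  with these poles and these points as roots. Its value at \<open>z = 0\<close> is the sum of the weights.
\<close>

lemma exists_blaschke_weights: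
  fixes S :: "complex set"
  assumes fin: "finite S" and out: "\<And>s. s \<in> S \<Longrightarrow> cmod s > 1"
  obtains c where
    "\<And>i. i \<in> S \<Longrightarrow> (\<Sum>j\<in>S. c j * (j * cnj i / (j * cnj i - 1))) = 1"
    "(\<Sum>j\<in>S. c j) = of_real (1 - (\<Prod>s\<in>S. 1 / (cmod s)\<^sup>2))"
proof (cases "S = {}")
  case True
  thus ?thesis by (intro that[of "\<lambda>_. 0"]) auto
next
  case False
  have S0: "s \<noteq> 0" if "s \<in> S" for s using out[OF that] by auto
  have S1: "j * cnj i \<noteq> 1" if "i \<in> S" "j \<in> S" for i j
    using mult_cnj_neq_1 out that by blast
  define N where "N = (\<Prod>s\<in>S. [:- (1 / cnj s), 1:])"
  define E where "E = (\<Prod>s\<in>S. [:- s, 1:])"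
  define P where "P = E - N"
  define D where "D s = (\<Prod>t\<in>S - {s}. s - t)" for s
  \<comment> \<open>the residues of \<open>P/E\<close>, rescaled to the basis functions \<open>s / (s - z)\<close>\<close>
  define c where "c s = - poly P s / (D s * s)" for s
  have polyE: "poly E z = (\<Prod>s\<in>S. z - s)" and polyN: "poly N z = (\<Prod>s\<in>S. z - 1 / cnj s)" for z
    by (simp_all add: E_def N_def poly_prod)
  have D0: "D s \<noteq> 0" for s using fin by (auto simp: D_def)
  have "degree P < card S"
  proof -
    have monic: "lead_coeff E = 1" "lead_coeff N = 1"
      by (auto simp: E_def N_def lead_coeff_prod)
    have deg: "degree E = card S" "degree N = card S"
      unfolding E_def N_def by (subst degree_prod_eq_sum_degree; simp)+
    show ?thesis
    proof (rule degree_lessI)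
      show "\<forall>k\<ge>card S. poly.coeff P k = 0"
      proof (intro allI impI)
        fix k assume "k \<ge> card S"
        thus "poly.coeff P k = 0"
          using monic deg by (cases "k = card S") (auto simp: P_def coeff_eq_0)
      qed
    qed (use False fin in \<open>auto simp: card_gt_0_iff\<close>)
  qed
  hence "P = (\<Sum>s\<in>S. Polynomial.smult (poly P s) (lagrange_basis S s))"
    by (rule lagrange_interpolation[OF fin])
  hence "poly P z = poly (\<Sum>s\<in>S. Polynomial.smult (poly P s) (lagrange_basis S s)) z" for z
    by (rule arg_cong)
  also have "poly (\<Sum>s\<in>S. Polynomial.smult (poly P s) (lagrange_basis S s)) z =
      (\<Sum>s\<in>S. poly P s * ((\<Prod>t\<in>S - {s}. z - t) / D s))" for z
    by (simp add: poly_sum poly_lagrange_basis D_def)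
  also have "(\<Sum>s\<in>S. poly P s * ((\<Prod>t\<in>S - {s}. z - t) / D s)) =
      poly E z * (\<Sum>s\<in>S. c s * (s / (s - z)))" if "z \<notin> S" for z
    unfolding sum_distrib_left
  proof (intro sum.cong refl)
    fix s assume s: "s \<in> S"
    have "poly E z = (z - s) * (\<Prod>t\<in>S - {s}. z - t)"
      unfolding polyE using fin s by (simp add: prod.remove)
    thus "poly P s * ((\<Prod>t\<in>S - {s}. z - t) / D s) = poly E z * (c s * (s / (s - z)))"
      using lagrange_term_eq[of z s "D s" "poly P s"] s that S0[OF s] D0[of s] by (auto simp: c_def)
  qed
  finally have P_eq: "poly P z = poly E z * (\<Sum>s\<in>S. c s * (s / (s - z)))" if "z \<notin> S" for z
    using that by blast
  have E0: "poly E z \<noteq> 0" if "z \<notin> S" for z using that fin by (auto simp: polyE)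
  show ?thesis
  proof (rule that)
    fix i assume i: "i \<in> S"
    define z where "z = 1 / cnj i"
    have z: "z \<notin> S" using S1[OF i, of z] S0[OF i] by (auto simp: z_def)
    have "poly N z = 0" using fin i by (auto simp: polyN z_def)
    hence "(\<Sum>s\<in>S. c s * (s / (s - z))) = 1"
      using P_eq[OF z] E0[OF z] by (simp add: P_def)
    moreover have "s / (s - z) = s * cnj i / (s * cnj i - 1)" if "s \<in> S" for s
      unfolding z_def using S0[OF i] by (intro shifted_geometric_term) simp
    ultimately show "(\<Sum>s\<in>S. c s * (s * cnj i / (s * cnj i - 1))) = 1" by simp
  next
    have 0: "0 \<notin> S" using S0 by auto
    have "(\<Sum>s\<in>S. c s * (s / (s - 0))) = (\<Sum>s\<in>S. c s)"
      by (intro sum.cong) (auto dest: S0)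
    hence "poly E 0 * (\<Sum>s\<in>S. c s) = poly E 0 - poly N 0"
      using P_eq[OF 0] by (simp add: P_def)
    hence "(\<Sum>s\<in>S. c s) = 1 - poly N 0 / poly E 0"
      using E0[OF 0] by (simp add: field_simps)
    also have "poly N 0 / poly E 0 = (\<Prod>s\<in>S. (0 - 1 / cnj s) / (0 - s))"
      by (simp only: polyE polyN prod_dividef)
    also have "\<dots> = (\<Prod>s\<in>S. of_real (1 / (cmod s)\<^sup>2))"
    proof (intro prod.cong refl)
      fix s assume "s \<in> S"
      have "(0 - 1 / cnj s) / (0 - s) = 1 / (s * cnj s)" by (simp add: mult.commute)
      thus "(0 - 1 / cnj s) / (0 - s) = of_real (1 / (cmod s)\<^sup>2)"
        by (simp only: complex_norm_square[symmetric] of_real_divide of_real_1 of_real_power)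
    qed
    finally show "(\<Sum>s\<in>S. c s) = of_real (1 - (\<Prod>s\<in>S. 1 / (cmod s)\<^sup>2))" by simp
  qed
qed

text \<open>
  The Gram form of the geometric sequences \<open>k \<mapsto> 1/i\<^sup>k\<close>: the last factor is their inner product
  \<open>\<Sum>k. 1 / (i * cnj j)\<^sup>k\<close> when all elements of \<open>S\<close> have modulus greater than \<open>1\<close>.
\<close>

definition kernel_form :: "complex set \<Rightarrow> (complex \<Rightarrow> complex) \<Rightarrow> complex" where
  "kernel_form S u = (\<Sum>i\<in>S. \<Sum>j\<in>S. u i * cnj (u j) * (i * cnj j / (i * cnj j - 1)))"

text \<open>
  Multiplying \<open>u i\<close> by \<open>i\<close> prepends the term \<open>t\<close> to the sequence \<open>k \<mapsto> \<Sum>i. u i / i\<^sup>k\<close>, which adds \<open>|t|\<^sup>2\<close> to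
  its square norm; in the kernel this is \<open>x K = x + K\<close> for \<open>K = x / (x - 1)\<close> and \<open>x = i * cnj j\<close>. Adding a multiple of
  \<open>c\<close> is adding a multiple of the reproducing kernel at \<open>0\<close>, whose inner product with any sequence is
  the initial term of that sequence, here \<open>t\<close>.
\<close>

lemma kernel_form_shift:
  fixes S :: "complex set" and c u :: "complex \<Rightarrow> complex" and \<eta> :: real
  assumes fin: "finite S" and out: "\<And>s. s \<in> S \<Longrightarrow> cmod s > 1"
    and c: "\<And>i. i \<in> S \<Longrightarrow> (\<Sum>j\<in>S. c j * (j * cnj i / (j * cnj i - 1))) = 1"
  defines "t \<equiv> (\<Sum>i\<in>S. i * u i)"
  shows "kernel_form S (\<lambda>i. \<eta> * c i + i * u i) =
    kernel_form S u + t * cnj t + \<eta> * (t + cnj t) + \<eta>\<^sup>2 * (\<Sum>i\<in>S. c i)"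
proof -
  define K where "K i j = i * cnj j / (i * cnj j - 1)" for i j
  have S1: "i * cnj j \<noteq> 1" if "i \<in> S" "j \<in> S" for i j
    using mult_cnj_neq_1 out that by blast
  have K: "i * cnj j * K i j = i * cnj j + K i j" if "i \<in> S" "j \<in> S" for i j
    using S1[OF that] by (simp add: K_def field_simps)
  have c1: "(\<Sum>j\<in>S. c j * K j i) = 1" if "i \<in> S" for i
    using c[OF that] by (simp add: K_def)
  have c2: "(\<Sum>j\<in>S. cnj (c j) * K i j) = 1" if "i \<in> S" for i
    using arg_cong[OF c1[OF that], of cnj] by (simp add: K_def mult.commute)
  have "kernel_form S (\<lambda>i. \<eta> * c i + i * u i) =
    (\<Sum>i\<in>S. \<Sum>j\<in>S. u i * cnj (u j) * K i j + (i * u i) * (cnj j * cnj (u j)) +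
       \<eta> * (i * u i) * (cnj (c j) * K i j) + \<eta> * (cnj j * cnj (u j)) * (c i * K i j) +
       \<eta>\<^sup>2 * cnj (c j) * (c i * K i j))"
    unfolding kernel_form_def K_def[symmetric]
  proof (intro sum.cong refl)
    fix i j assume ij: "i \<in> S" "j \<in> S"
    have "(\<eta> * c i + i * u i) * cnj (\<eta> * c j + j * u j) * K i j =
       u i * cnj (u j) * (i * cnj j * K i j) +
       \<eta> * (i * u i) * (cnj (c j) * K i j) + \<eta> * (cnj j * cnj (u j)) * (c i * K i j) +
       \<eta>\<^sup>2 * cnj (c j) * (c i * K i j)"
      by (simp add: algebra_simps power2_eq_square)
    thus "(\<eta> * c i + i * u i) * cnj (\<eta> * c j + j * u j) * K i j =
       u i * cnj (u j) * K i j + (i * u i) * (cnj j * cnj (u j)) +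
       \<eta> * (i * u i) * (cnj (c j) * K i j) + \<eta> * (cnj j * cnj (u j)) * (c i * K i j) +
       \<eta>\<^sup>2 * cnj (c j) * (c i * K i j)"
      unfolding K[OF ij] by (simp add: algebra_simps)
  qed
  also have "\<dots> = kernel_form S u + t * cnj t
      + \<eta> * (\<Sum>i\<in>S. i * u i * (\<Sum>j\<in>S. cnj (c j) * K i j))
      + \<eta> * (\<Sum>j\<in>S. cnj j * cnj (u j) * (\<Sum>i\<in>S. c i * K i j))
      + \<eta>\<^sup>2 * (\<Sum>j\<in>S. cnj (c j) * (\<Sum>i\<in>S. c i * K i j))"
  proof -
    have 1: "(\<Sum>i\<in>S. \<Sum>j\<in>S. (i * u i) * (cnj j * cnj (u j))) = t * cnj t"
      by (simp add: t_def sum_product)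
    have 2: "(\<Sum>i\<in>S. \<Sum>j\<in>S. f j * (c i * K i j)) = (\<Sum>j\<in>S. f j * (\<Sum>i\<in>S. c i * K i j))" for f
      by (subst sum.swap) (simp add: sum_distrib_left)
    show ?thesis
      unfolding sum.distrib 1 2 by (simp add: kernel_form_def K_def sum_distrib_left mult.assoc)
  qed
  also have "\<dots> = kernel_form S u + t * cnj t + \<eta> * (\<Sum>i\<in>S. i * u i)
      + \<eta> * (\<Sum>j\<in>S. cnj j * cnj (u j)) + \<eta>\<^sup>2 * (\<Sum>j\<in>S. cnj (c j))"
    by (simp add: c1 c2)
  also have "(\<Sum>j\<in>S. cnj (c j)) = (\<Sum>i\<in>S. c i)"
  proof -
    have "(\<Sum>j\<in>S. cnj (c j)) = (\<Sum>j\<in>S. cnj (c j) * (\<Sum>i\<in>S. c i * K i j))"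
      by (simp add: c1)
    also have "\<dots> = (\<Sum>i\<in>S. c i * (\<Sum>j\<in>S. cnj (c j) * K i j))"
      unfolding sum_distrib_left by (subst sum.swap) (simp add: mult_ac)
    also have "\<dots> = (\<Sum>i\<in>S. c i)" by (simp add: c2)
    finally show ?thesis .
  qed
  finally show ?thesis by (simp add: t_def algebra_simps)
qed

section \<open>Averaging Gaussians\<close>

text \<open>
  This is Hoeffding's lemma for a symmetric two-point distribution.
\<close>

lemma cosh_le_exp_half_square: "cosh x \<le> exp (x\<^sup>2 / 2)" for x :: real
proof -
  have *: "cosh y \<le> exp (y\<^sup>2 / 2)" if "y \<ge> 0" for y :: real
  proof -
    define z where "z = (1 + exp (2 * y)) / 2"
    have z: "z > 0" unfolding z_def by (intro divide_pos_pos add_pos_pos) auto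
    have "- (2 * y) * (1 / 2) + ln (1 + 1 / 2 * (exp (2 * y) - 1)) \<le> (2 * y)\<^sup>2 / 8"
      using that by (intro Hoeffdings_lemma_aux) auto
    also have "1 + 1 / 2 * (exp (2 * y) - 1) = z" by (simp add: z_def field_simps)
    finally have "ln z \<le> y + y\<^sup>2 / 2" by (simp add: power2_eq_square)
    hence "exp (ln z) \<le> exp (y + y\<^sup>2 / 2)" by (simp only: exp_le_cancel_iff)
    hence "z * exp (- y) \<le> exp (y + y\<^sup>2 / 2) * exp (- y)"
      using z by (intro mult_right_mono) (auto simp: exp_ln)
    also have "\<dots> = exp (y\<^sup>2 / 2)" by (simp flip: exp_add)
    also have "z * exp (- y) = cosh y"
      by (simp add: z_def cosh_field_def distrib_right flip: exp_add)
    finally show ?thesis .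
  qed
  show ?thesis using *[of "\<bar>x\<bar>"] by (cases "x \<ge> 0") auto
qed

text \<open>
  The averaged inequality for one step. Here \<open>q\<close> is the old value of the form, \<open>y = |t|\<^sup>2\<close> and \<open>x = Re t\<close>; the three
  exponents belong to \<open>\<eta> = 2, 0, -2\<close>. The factor \<open>exp(-y/8)\<close> outweighs the hyperbolic cosine that the
  average of the outer terms produces, precisely because \<open>x\<^sup>2 \<le> y\<close>; this is what determines the
  constant \<open>8\<close>.
\<close>

lemma gaussian_average_le:
  fixes q x y a :: real
  assumes y: "y \<ge> x\<^sup>2"
  shows "exp (- (q + y + 4 * x + 4 * a) / 8) + 2 * exp (- (q + y) / 8) + exp (- (q + y - 4 * x + 4 * a) / 8)
       \<le> 4 * ((1 + exp (- a / 2)) / 2) * exp (- q / 8)"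
proof -
  have eq: "exp (- (q + y + 4 * x + 4 * a) / 8) + 2 * exp (- (q + y) / 8) + exp (- (q + y - 4 * x + 4 * a) / 8)
     = 2 * exp (- q / 8) * (exp (- y / 8) * (1 + exp (- a / 2) * cosh (x / 2)))"
  proof -
    have "exp (- (q + y + 4 * x + 4 * a) / 8) = exp (- q / 8) * exp (- y / 8) * exp (- a / 2) * exp (- (x / 2))"
      "exp (- (q + y - 4 * x + 4 * a) / 8) = exp (- q / 8) * exp (- y / 8) * exp (- a / 2) * exp (x / 2)"
      "exp (- (q + y) / 8) = exp (- q / 8) * exp (- y / 8)"
      by (simp_all flip: exp_add)
    thus ?thesis by (simp only: cosh_field_def) (simp add: algebra_simps)
  qed
  have "exp (- y / 8) * (1 + exp (- a / 2) * cosh (x / 2)) \<le> 1 + exp (- a / 2)"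
  proof -
    have "exp (- y / 8) * cosh (x / 2) \<le> exp (- (x\<^sup>2) / 8) * exp ((x / 2)\<^sup>2 / 2)"
      using y by (intro mult_mono cosh_le_exp_half_square) auto
    also have "\<dots> = 1" by (simp add: power_divide flip: exp_add)
    finally have "exp (- a / 2) * (exp (- y / 8) * cosh (x / 2)) \<le> exp (- a / 2) * 1"
      by (intro mult_left_mono) auto
    moreover have "exp (- y / 8) \<le> 1" using order_trans[OF zero_le_power2 y] by simp
    moreover have "exp (- y / 8) * (1 + exp (- a / 2) * cosh (x / 2)) =
        exp (- y / 8) + exp (- a / 2) * (exp (- y / 8) * cosh (x / 2))"
      by (simp only: distrib_left mult_ac mult_1_right)
    ultimately show ?thesis by linarith
  qed
  hence "2 * exp (- q / 8) * (exp (- y / 8) * (1 + exp (- a / 2) * cosh (x / 2)))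
      \<le> 2 * exp (- q / 8) * (1 + exp (- a / 2))"
    by (intro mult_left_mono) auto
  also have "\<dots> = 4 * ((1 + exp (- a / 2)) / 2) * exp (- q / 8)" by simp
  finally show ?thesis unfolding eq .
qed

section \<open>The lower bound\<close>

lemma kernel_form_cong:
  "(\<And>i. i \<in> S \<Longrightarrow> u i = v i) \<Longrightarrow> kernel_form S u = kernel_form S v"
  by (simp add: kernel_form_def cong: sum.cong)

lemma poly_pCons_of_int:
  "poly (of_int_poly (pCons s d)) (z::complex) = of_int s + z * poly (of_int_poly d) z"
  by (simp add: of_int_hom.map_poly_pCons_hom)

text \<open>
  A collision makes \<open>p - q\<close> vanish at all conjugates of \<open>a\<close>, in particular on \<open>S\<close>, and then
  its weight \<open>F\<close> is \<open>1\<close>. The weight of \<open>p - q\<close> shrinks on average by the factor \<open>\<rho>\<close> with each pair of signs.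
\<close>

lemma collisions_le_of_roots_outside:
  fixes p :: "int poly" and a :: complex
  assumes irr: "irreducible p" and a: "poly (of_int_poly p) a = 0"
    and fin: "finite S" and out: "\<And>s. s \<in> S \<Longrightarrow> cmod s > 1"
    and roots: "\<And>s. s \<in> S \<Longrightarrow> poly (of_int_poly p) s = 0"
  defines "b \<equiv> 1 - (\<Prod>s\<in>S. 1 / (cmod s)\<^sup>2)"
  shows "(\<Sum>p\<in>sign_polys n. \<Sum>q\<in>sign_polys n. of_bool (poly (of_int_poly (p - q)) a = 0))
       \<le> (4 * ((1 + exp (- b / 2)) / 2)) ^ n"
proof -
  obtain c where c: "\<And>i. i \<in> S \<Longrightarrow> (\<Sum>j\<in>S. c j * (j * cnj i / (j * cnj i - 1))) = 1"
    and b: "(\<Sum>j\<in>S. c j) = of_real b"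
    using exists_blaschke_weights[OF fin out] unfolding b_def by blast
  define u :: "int poly \<Rightarrow> complex \<Rightarrow> complex" where "u d i = c i * poly (of_int_poly d) i" for d i
  define F where "F d = exp (- Re (kernel_form S (u d)) / 8)" for d
  define \<rho> where "\<rho> = (1 + exp (- b / 2)) / 2"
  have deg: "degree p > 0" using irr a by (rule irreducible_root_imp_degree_pos)
  have "of_bool (poly (of_int_poly d) a = 0) \<le> F d" for d
  proof (cases "poly (of_int_poly d) a = 0")
    case True
    then obtain e where e: "d = p * e"
      using irreducible_dvd_of_common_root[OF irr deg a] by auto
    have "kernel_form S (u d) = kernel_form S (\<lambda>_. 0)"
      by (rule kernel_form_cong) (simp add: u_def e of_int_poly_hom.hom_mult roots)
    thus ?thesis by (simp add: F_def kernel_form_def)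
  qed (simp add: F_def)
  hence "(\<Sum>p\<in>sign_polys n. \<Sum>q\<in>sign_polys n. of_bool (poly (of_int_poly (p - q)) a = 0))
      \<le> (\<Sum>p\<in>sign_polys n. \<Sum>q\<in>sign_polys n. F (p - q))"
    by (intro sum_mono) auto
  also have "\<dots> \<le> (4 * \<rho>) ^ n * F 0"
  proof (rule sum_sign_polys_diff_le)
    fix d
    define t where "t = (\<Sum>i\<in>S. i * u d i)"
    have shift: "Re (kernel_form S (u (pCons s d))) =
        Re (kernel_form S (u d)) + (cmod t)\<^sup>2 + 2 * s * Re t + s\<^sup>2 * b" for s :: int
    proof -
      have "u (pCons s d) = (\<lambda>i. of_real (of_int s) * c i + i * u d i)"
        by (simp add: u_def poly_pCons_of_int algebra_simps fun_eq_iff)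
      hence "kernel_form S (u (pCons s d)) = kernel_form S (u d) + t * cnj t
          + of_real (of_int s) * (t + cnj t) + (of_real (of_int s))\<^sup>2 * of_real b"
        using kernel_form_shift[OF fin out c, where u="u d" and \<eta>="of_int s"] by (simp add: t_def b)
      also have "\<dots> = kernel_form S (u d) + of_real ((cmod t)\<^sup>2 + 2 * s * Re t + s\<^sup>2 * b)"
        by (simp add: complex_add_cnj flip: complex_norm_square)
      finally show ?thesis by simp
    qed
    have "(Re t)\<^sup>2 \<le> (cmod t)\<^sup>2"
      using abs_Re_le_cmod[of t] by (simp add: abs_le_square_iff[symmetric])
    from gaussian_average_le[OF this, of "Re (kernel_form S (u d))" b]
    show "F (pCons 2 d) + 2 * F (pCons 0 d) + F (pCons (-2) d) \<le> 4 * \<rho> * F d"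
      unfolding F_def shift \<rho>_def by (simp add: algebra_simps)
  qed (simp add: \<rho>_def add_nonneg_nonneg)
  also have "F 0 = 1" by (simp add: F_def u_def kernel_form_def)
  finally show ?thesis by (simp add: \<rho>_def)
qed

text \<open>
  Half the difference of two sign polynomials has coefficients in \<open>{-1, 0, 1}\<close>, so its leading
  coefficient is not divisible by an integer of absolute value at least \<open>2\<close>.
\<close>

lemma eval_sign_polys_eq_imp_eq:
  fixes m :: "int poly"
  assumes irr: "irreducible m" and a: "poly (of_int_poly m) (a::complex) = 0"
    and lead: "\<bar>lead_coeff m\<bar> \<ge> 2"
    and p: "p \<in> sign_polys n" and q: "q \<in> sign_polys n"
    and eq: "poly (of_int_poly (p - q)) a = 0"
  shows "p = q"
proof -
  define e where "e = map_poly (\<lambda>x. x div 2) (p - q)"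
  have c: "poly.coeff e i = (poly.coeff p i - poly.coeff q i) div 2" for i
    by (simp add: e_def coeff_map_poly)
  have small: "\<bar>poly.coeff e i\<bar> \<le> 1" and double: "2 * poly.coeff e i = poly.coeff p i - poly.coeff q i" for i
  proof -
    have "poly.coeff p i \<in> {-1, 1} \<and> poly.coeff q i \<in> {-1, 1} \<or> poly.coeff p i = 0 \<and> poly.coeff q i = 0"
      using p q by (cases "i < n") (auto simp: sign_polys_def)
    thus "\<bar>poly.coeff e i\<bar> \<le> 1" "2 * poly.coeff e i = poly.coeff p i - poly.coeff q i"
      unfolding c by auto
  qed
  have e2: "p - q = Polynomial.smult 2 e"
    by (rule poly_eqI) (simp add: double)
  hence "poly (of_int_poly e) a = 0"
    using eq by (simp add: of_int_hom.map_poly_hom_smult)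
  hence "m dvd e"
    using irreducible_dvd_of_common_root[OF irr irreducible_root_imp_degree_pos[OF irr a] a] by blast
  then obtain k where k: "e = m * k" by auto
  have "e = 0"
  proof (rule ccontr)
    assume "e \<noteq> 0"
    hence "lead_coeff k \<noteq> 0" using k by auto
    hence "1 \<le> \<bar>lead_coeff k\<bar>" by linarith
    hence "\<bar>lead_coeff m\<bar> * 1 \<le> \<bar>lead_coeff m\<bar> * \<bar>lead_coeff k\<bar>" by (intro mult_left_mono) auto
    also have "\<dots> = \<bar>lead_coeff e\<bar>" by (simp add: k lead_coeff_mult abs_mult)
    also have "\<dots> \<le> 1" by (rule small)
    finally show False using lead by simp
  qed
  thus ?thesis using e2 by simp
qed

text \<open>
  Both sides are of order \<open>log M\<close> as \<open>M\<close> tends to \<open>1\<close>, and both stay bounded. With \<open>l = min(1, log M)\<close> and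
  \<open>b = 1 - 1/M\<^sup>2\<close> the crude estimates \<open>l/2 \<le> b\<close> and \<open>b/8 \<le> 1 - \<rho> \<le> - log \<rho>\<close> give the constant.
\<close>

lemma neg_log_collision_rate_ge:
  fixes M :: real
  assumes M: "M \<ge> 1"
  shows "1 / 16 * min 1 (log 2 M) \<le> - log 2 ((1 + exp (- (1 - 1 / M\<^sup>2) / 2)) / 2)"
proof -
  define l where "l = min 1 (log 2 M)"
  define b where "b = 1 - 1 / M\<^sup>2"
  define \<rho> where "\<rho> = (1 + exp (- b / 2)) / 2"
  have l: "0 \<le> l" "l \<le> 1" using M by (auto simp: l_def)
  have ratio: "x / 2 \<le> 1 - 1 / (1 + x)" if "0 \<le> x" "x \<le> 1" for x :: real
  proof -
    have "x / 2 \<le> x / (1 + x)" using that by (intro divide_left_mono) auto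
    also have "\<dots> = ((1 + x) - 1) / (1 + x)" by simp
    also have "\<dots> = 1 - 1 / (1 + x)" using that by (subst diff_divide_distrib) simp
    finally show ?thesis .
  qed
  have "l / 2 \<le> b"
  proof -
    have "l \<le> log 2 M" by (simp add: l_def)
    hence "l * ln 2 \<le> ln M" by (simp add: log_def pos_le_divide_eq)
    moreover have "l * (1 / 2) \<le> l * ln 2" using l ln2_ge_two_thirds by (intro mult_left_mono) auto
    ultimately have "l \<le> 2 * ln M" by simp
    hence "exp l \<le> exp (2 * ln M)" by simp
    also have "\<dots> = M\<^sup>2" using M by (simp add: exp_double)
    finally have "1 + l \<le> M\<^sup>2" using exp_ge_add_one_self[of l] by linarith
    hence "1 / M\<^sup>2 \<le> 1 / (1 + l)" using l by (intro divide_left_mono mult_pos_pos) auto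
    thus ?thesis using ratio[of l] l by (simp add: b_def)
  qed
  have b: "0 \<le> b" "b \<le> 1" using M by (auto simp: b_def)
  define w where "w = exp (- b / 2)"
  have "inverse (exp (b / 2)) \<le> inverse (1 + b / 2)"
    using b by (intro le_imp_inverse_le exp_ge_add_one_self) auto
  hence "w \<le> 1 / (1 + b / 2)" by (simp add: w_def exp_minus inverse_eq_divide)
  hence "b / 4 \<le> 1 - w" using ratio[of "b / 2"] b by simp
  hence "b / 8 \<le> 1 - \<rho>" unfolding \<rho>_def w_def[symmetric] by (simp add: add_divide_distrib)
  moreover have \<rho>: "0 < \<rho>" by (simp add: \<rho>_def add_pos_pos)
  ultimately have ln: "b / 8 \<le> - ln \<rho>" using ln_le_minus_one[OF \<rho>] by linarith
  have "- ln \<rho> * 1 \<le> - ln \<rho> * (1 / ln 2)"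
    using ln b ln2_le_25_over_36 by (intro mult_left_mono) auto
  hence "- ln \<rho> \<le> - log 2 \<rho>" by (simp add: log_def)
  hence "1 / 16 * l \<le> - log 2 \<rho>" using ln \<open>l / 2 \<le> b\<close> by linarith
  thus ?thesis by (simp add: l_def b_def \<rho>_def)
qed

text \<open>
  If the leading coefficient of the minimal polynomial is not \<open>\<plusminus>1\<close>, distinct sign sequences give
  distinct sums and the collision probability is \<open>1/2\<^sup>n\<close>. Otherwise the roots outside the unit disc
  carry the whole Mahler measure.
\<close>

lemma bernoulli_entropy_ge_mahler:
  assumes "algebraic a"
  shows "1 / 16 * min 1 (log 2 (mahler_measure_of a)) \<le> bernoulli_entropy a"
proof -
  define p where "p = int_minpoly a"
  have irr: "irreducible p" and a: "poly (of_int_poly p) a = 0"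
    using int_minpoly[OF assms] by (auto simp: p_def)
  have deg: "degree p > 0" using irr a by (rule irreducible_root_imp_degree_pos)
  define R where "R = {z::complex. poly (of_int_poly p) z = 0}"
  define S where "S = {z \<in> R. cmod z > 1}"
  have finR: "finite R" unfolding R_def using deg by (intro poly_roots_finite) auto
  have M: "mahler_measure_of a = \<bar>lead_coeff p\<bar> * (\<Prod>z\<in>S. cmod z)"
  proof -
    have "(\<Prod>z\<in>R. max 1 (cmod z)) = (\<Prod>z\<in>S. max 1 (cmod z))"
      using finR by (intro prod.mono_neutral_right) (auto simp: S_def)
    also have "\<dots> = (\<Prod>z\<in>S. cmod z)" by (intro prod.cong) (auto simp: S_def)
    finally show ?thesis
      using mahler_measure_irreducible[OF irr deg] by (simp add: mahler_measure_of_def p_def R_def)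
  qed
  show ?thesis
  proof (cases "\<bar>lead_coeff p\<bar> \<ge> 2")
    case True
    have "- log 2 (1 / 2) \<le> bernoulli_entropy a"
    proof (rule bernoulli_entropy_ge_of_collisions)
      fix n
      have "(\<Sum>q\<in>sign_polys n. of_bool (poly (of_int_poly (r - q)) a = 0)) =
          (\<Sum>q\<in>sign_polys n. if q = r then 1 else 0 :: real)" if "r \<in> sign_polys n" for r
        using eval_sign_polys_eq_imp_eq[OF irr a True that] by (intro sum.cong) auto
      hence "(\<Sum>r\<in>sign_polys n. \<Sum>q\<in>sign_polys n. of_bool (poly (of_int_poly (r - q)) a = 0)) =
          (\<Sum>r\<in>sign_polys n. 1 :: real)"
        by (intro sum.cong) (auto simp: finite_sign_polys)
      thus "(\<Sum>r\<in>sign_polys n. \<Sum>q\<in>sign_polys n. of_bool (poly (of_int_poly (r - q)) a = 0))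
          \<le> (4 * (1 / 2) :: real) ^ n"
        by (simp add: card_sign_polys)
    qed simp
    moreover have "- log 2 (1 / 2) = (1 :: real)" by (simp add: log_def ln_div)
    ultimately have "1 \<le> bernoulli_entropy a" by linarith
    moreover have "min 1 (log 2 (mahler_measure_of a)) \<le> 1" by simp
    ultimately show ?thesis by linarith
  next
    case False
    moreover have "lead_coeff p \<noteq> 0" using deg by auto
    ultimately have "\<bar>lead_coeff p\<bar> = 1" by linarith
    hence M1: "mahler_measure_of a = (\<Prod>z\<in>S. cmod z)" using M by simp
    have prod: "(\<Prod>s\<in>S. 1 / (cmod s)\<^sup>2) = 1 / (mahler_measure_of a)\<^sup>2"
      by (simp only: M1 prod_dividef prod_power_distrib prod.neutral_const)
    have finS: "finite S" and out: "\<And>s. s \<in> S \<Longrightarrow> cmod s > 1"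
      and roots: "\<And>s. s \<in> S \<Longrightarrow> poly (of_int_poly p) s = 0"
      using finR by (simp_all add: S_def R_def)
    have "- log 2 ((1 + exp (- (1 - 1 / (mahler_measure_of a)\<^sup>2) / 2)) / 2) \<le> bernoulli_entropy a"
    proof (rule bernoulli_entropy_ge_of_collisions)
      fix n
      show "(\<Sum>p\<in>sign_polys n. \<Sum>q\<in>sign_polys n. of_bool (poly (of_int_poly (p - q)) a = 0))
        \<le> (4 * ((1 + exp (- (1 - 1 / (mahler_measure_of a)\<^sup>2) / 2)) / 2)) ^ n"
        unfolding prod[symmetric] by (rule collisions_le_of_roots_outside[OF irr a finS out roots])
    qed (intro divide_pos_pos add_pos_pos, auto)
    moreover have "mahler_measure_of a \<ge> 1"
      unfolding M1 by (intro prod_ge_1) (auto dest: out)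
    note neg_log_collision_rate_ge[OF this]
    ultimately show ?thesis by linarith
  qed
qed

section \<open>The upper bound\<close>

lemma poly_of_int_cnj: "poly (of_int_poly d) (cnj z) = cnj (poly (of_int_poly d) z)"
  by (simp add: poly_altdef)

text \<open>
  Since the leading coefficient is a unit, division with remainder stays within integer polynomials,
  and the remainder agrees with \<open>d\<close> up to sign at the roots of \<open>p\<close>. Interpolation bounds its coefficients
  by a constant, depending only on \<open>p\<close>, times the size of these values; integers below \<open>1\<close> in absolute
  value are \<open>0\<close>.
\<close>

lemma small_at_roots_imp_dvd:
  fixes p :: "int poly"
  assumes irr: "irreducible p" and deg: "degree p > 0" and lead: "\<bar>lead_coeff p\<bar> = 1"
  defines "R \<equiv> {z::complex. poly (of_int_poly p) z = 0}"
  obtains \<delta> :: real where "\<delta> > 0"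
    "\<And>d. (\<And>z. z \<in> R \<Longrightarrow> cmod (poly (of_int_poly d) z) \<le> \<delta>) \<Longrightarrow> p dvd d"
proof -
  have p0: "p \<noteq> 0" using deg by auto
  have fin: "finite R" unfolding R_def using p0 by (intro poly_roots_finite) simp
  have card: "card R = degree p" unfolding R_def by (rule irreducible_card_roots[OF irr deg])
  define K where "K = (\<Sum>i\<le>degree p. \<Sum>z\<in>R. cmod (poly.coeff (lagrange_basis R z) i))"
  have K: "K \<ge> 0" unfolding K_def by (intro sum_nonneg) auto
  show ?thesis
  proof (rule that)
    show "1 / (1 + K) > 0" using K by simp
  next
    fix d assume small: "\<And>z. z \<in> R \<Longrightarrow> cmod (poly (of_int_poly d) z) \<le> 1 / (1 + K)"
    obtain q r where qr: "pseudo_divmod d p = (q, r)" by (cases "pseudo_divmod d p")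
    define e where "e = lead_coeff p ^ (Suc (degree d) - degree p)"
    have e: "\<bar>e\<bar> = 1" using lead by (simp add: e_def power_abs)
    have eq: "Polynomial.smult e d = p * q + r" and deg_r: "r = 0 \<or> degree r < degree p"
      using pseudo_divmod[OF p0 qr] by (simp_all add: e_def)
    have r_small: "cmod (poly (of_int_poly r) z) \<le> 1 / (1 + K)" if "z \<in> R" for z
    proof -
      have "of_int_poly (Polynomial.smult e d) = of_int_poly p * of_int_poly q + (of_int_poly r :: complex poly)"
        unfolding eq by (simp add: of_int_poly_hom.hom_add of_int_poly_hom.hom_mult)
      hence "of_int e * poly (of_int_poly d) z = poly (of_int_poly p) z * poly (of_int_poly q) z + poly (of_int_poly r) z"
        by (metis of_int_hom.map_poly_hom_smult poly_add poly_mult poly_smult)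
      hence "poly (of_int_poly r) z = of_int e * poly (of_int_poly d) z" using that by (simp add: R_def)
      hence "cmod (poly (of_int_poly r) z) = \<bar>of_int e\<bar> * cmod (poly (of_int_poly d) z)"
        by (simp add: norm_mult)
      also have "\<bar>of_int e\<bar> = (1 :: real)" using e by (metis of_int_1 of_int_abs)
      finally show ?thesis using small[OF that] by simp
    qed
    have "r = 0"
    proof (rule ccontr)
      assume r: "r \<noteq> 0"
      hence "degree r < degree p" using deg_r by simp
      hence "degree (of_int_poly r :: complex poly) < card R" by (simp add: card)
      note lag = lagrange_interpolation[OF fin this]
      define i where "i = degree r"
      have "of_int (poly.coeff r i) = poly.coeff (of_int_poly r :: complex poly) i" by simp
      also have "\<dots> = poly.coeff (\<Sum>z\<in>R. Polynomial.smult (poly (of_int_poly r) z) (lagrange_basis R z)) i"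
        by (rule arg_cong[OF lag])
      also have "\<dots> = (\<Sum>z\<in>R. poly (of_int_poly r) z * poly.coeff (lagrange_basis R z) i)"
        by (simp add: coeff_sum)
      finally have "cmod (of_int (poly.coeff r i)) \<le> (\<Sum>z\<in>R. cmod (poly (of_int_poly r) z * poly.coeff (lagrange_basis R z) i))"
        by (simp only: norm_sum)
      also have "\<dots> \<le> (\<Sum>z\<in>R. 1 / (1 + K) * cmod (poly.coeff (lagrange_basis R z) i))"
        unfolding norm_mult by (intro sum_mono mult_right_mono r_small) auto
      also have "\<dots> = 1 / (1 + K) * (\<Sum>z\<in>R. cmod (poly.coeff (lagrange_basis R z) i))"
        by (simp only: sum_distrib_left)
      also have "\<dots> \<le> 1 / (1 + K) * K"
        using K \<open>degree r < degree p\<close> unfolding K_def i_def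
        by (intro mult_left_mono member_le_sum) (auto intro: sum_nonneg)
      also have "\<dots> < 1" using K by simp
      finally have "cmod (of_int (poly.coeff r i)) < 1" .
      moreover have "cmod (of_int (poly.coeff r i)) = real_of_int \<bar>poly.coeff r i\<bar>"
        by simp
      ultimately have "poly.coeff r i = 0" by linarith
      thus False using r by (simp add: i_def)
    qed
    hence "p dvd Polynomial.smult e d" using eq by simp
    hence "p dvd Polynomial.smult e (Polynomial.smult e d)" by (rule dvd_smult)
    moreover have "e * e = 1" using e by (metis abs_mult_self_eq mult_1)
    ultimately show "p dvd d" by simp
  qed
qed

text \<open>
  The value of an integer polynomial at a pair of conjugate roots is one complex number, that is, two
  real ones. Attaching the real part to one root of the pair and the imaginary part to the other
  leaves exactly one real coordinate for every root, real roots included. With both parts for every root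
  the number of cells would be about the square of what is needed.
\<close>

definition real_form :: "complex \<Rightarrow> int poly \<Rightarrow> real" where
  "real_form z d = (if Im z \<ge> 0 then Re (poly (of_int_poly d) z) else Im (poly (of_int_poly d) z))"

lemma cmod_le_of_real_forms:
  assumes z: "\<bar>real_form z d\<bar> \<le> \<tau>" and cz: "\<bar>real_form (cnj z) d\<bar> \<le> \<tau>"
  shows "cmod (poly (of_int_poly d) z) \<le> 2 * \<tau>"
proof -
  have "\<bar>Re (poly (of_int_poly d) z)\<bar> + \<bar>Im (poly (of_int_poly d) z)\<bar> \<le> 2 * \<tau>"
  proof (cases "Im z = 0")
    case True
    hence "cnj z = z" by (simp add: complex_eq_iff)
    hence "poly (of_int_poly d) z = cnj (poly (of_int_poly d) z)"
      using poly_of_int_cnj[of d z] by simp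
    hence "Im (poly (of_int_poly d) z) = 0" by (simp add: complex_eq_iff)
    thus ?thesis using True z by (simp add: real_form_def)
  next
    case False
    thus ?thesis using z cz by (cases "Im z > 0") (auto simp: real_form_def poly_of_int_cnj)
  qed
  thus ?thesis using cmod_le[of "poly (of_int_poly d) z"] by linarith
qed

lemma real_form_diff: "real_form z (p - q) = real_form z p - real_form z q"
  by (simp add: real_form_def of_int_poly_hom.hom_minus)

lemma abs_real_form_sign_poly_le:
  assumes "q \<in> sign_polys n"
  shows "\<bar>real_form z q\<bar> \<le> n * max 1 (cmod z) ^ n"
proof -
  have "\<bar>real_form z q\<bar> \<le> cmod (poly (of_int_poly q) z)"
    by (simp add: real_form_def abs_Re_le_cmod abs_Im_le_cmod)
  also have "\<dots> \<le> (\<Sum>i<n. cmod (of_int (poly.coeff q i) * z ^ i))"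
    unfolding poly_sign_poly[OF assms] by (rule norm_sum)
  also have "\<dots> \<le> (\<Sum>i<n. max 1 (cmod z) ^ n)"
  proof (rule sum_mono)
    fix i assume i: "i \<in> {..<n}"
    have "cmod (of_int (poly.coeff q i) * z ^ i) = cmod z ^ i"
      using assms i by (auto simp: sign_polys_def norm_mult norm_power)
    also have "\<dots> \<le> max 1 (cmod z) ^ i" by (intro power_mono) auto
    also have "\<dots> \<le> max 1 (cmod z) ^ n" using i by (intro power_increasing) auto
    finally show "cmod (of_int (poly.coeff q i) * z ^ i) \<le> max 1 (cmod z) ^ n" .
  qed
  also have "\<dots> = n * max 1 (cmod z) ^ n" by simp
  finally show ?thesis .
qed

lemma card_image_le_card_image:
  assumes "finite A" "\<And>x y. x \<in> A \<Longrightarrow> y \<in> A \<Longrightarrow> g x = g y \<Longrightarrow> f x = f y"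
  shows "card (f ` A) \<le> card (g ` A)"
proof -
  have "f ` A \<subseteq> (\<lambda>y. f (inv_into A g y)) ` (g ` A)"
  proof
    fix w assume "w \<in> f ` A"
    then obtain x where x: "x \<in> A" "w = f x" by auto
    have "inv_into A g (g x) \<in> A" "g (inv_into A g (g x)) = g x"
      using x by (auto intro: inv_into_into f_inv_into_f)
    hence "w = f (inv_into A g (g x))" using assms(2) x by metis
    thus "w \<in> (\<lambda>y. f (inv_into A g y)) ` (g ` A)" using x by blast
  qed
  thus ?thesis using assms(1) by (meson card_image_le card_mono finite_imageI order_trans)
qed

text \<open>
  Cells of side \<open>\<tau>\<close> in the space of the real coordinates separate the values, and \<open>C\<close> absorbs the
  mesh size and the rounding.
\<close>

lemma card_values_le_mahler:
  fixes p :: "int poly" and a :: complex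
  assumes irr: "irreducible p" and a: "poly (of_int_poly p) a = 0" and lead: "\<bar>lead_coeff p\<bar> = 1"
  obtains C :: real where "C \<ge> 1"
    "\<And>n. card ((\<lambda>q. poly (of_int_poly q) a) ` sign_polys n) \<le> (C * (real n + 1)) ^ degree p * mahler_measure p ^ n"
proof -
  define R where "R = {z::complex. poly (of_int_poly p) z = 0}"
  have deg: "degree p > 0" using irr a by (rule irreducible_root_imp_degree_pos)
  have fin: "finite R" unfolding R_def using deg by (intro poly_roots_finite) auto
  have card: "card R = degree p" unfolding R_def by (rule irreducible_card_roots[OF irr deg])
  have cnjR: "cnj z \<in> R" if "z \<in> R" for z using that by (simp add: R_def poly_of_int_cnj)
  obtain \<delta> where \<delta>: "\<delta> > 0"
    and dvd: "\<And>d. (\<And>z. z \<in> R \<Longrightarrow> cmod (poly (of_int_poly d) z) \<le> \<delta>) \<Longrightarrow> p dvd d"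
    unfolding R_def by (rule small_at_roots_imp_dvd[OF irr deg lead]) blast
  define \<tau> where "\<tau> = \<delta> / 2"
  have \<tau>: "\<tau> > 0" using \<delta> by (simp add: \<tau>_def)
  define \<Phi> where "\<Phi> q = (\<lambda>z\<in>R. \<lfloor>real_form z q / \<tau>\<rfloor>)" for q
  have same_cell: "poly (of_int_poly q) a = poly (of_int_poly q') a" if eq: "\<Phi> q = \<Phi> q'" for q q'
  proof -
    have close: "\<bar>real_form z (q - q')\<bar> \<le> \<tau>" if "z \<in> R" for z
    proof -
      have "\<lfloor>real_form z q / \<tau>\<rfloor> = \<lfloor>real_form z q' / \<tau>\<rfloor>"
        using fun_cong[OF eq, of z] that by (simp add: \<Phi>_def)
      hence "\<bar>real_form z q / \<tau> - real_form z q' / \<tau>\<bar> \<le> 1" by linarith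
      thus ?thesis
        using \<tau> by (simp add: real_form_diff diff_divide_distrib[symmetric] abs_divide)
    qed
    have "p dvd q - q'"
    proof (rule dvd)
      fix z assume "z \<in> R"
      thus "cmod (poly (of_int_poly (q - q')) z) \<le> \<delta>"
        using cmod_le_of_real_forms[OF close close[OF cnjR]] by (simp add: \<tau>_def)
    qed
    then obtain k where "q - q' = p * k" by auto
    hence "poly (of_int_poly (q - q')) a = poly (of_int_poly (p * k)) a" by simp
    thus ?thesis using a by (simp add: of_int_poly_hom.hom_minus of_int_poly_hom.hom_mult)
  qed
  define C where "C = 2 / \<tau> + 3"
  show ?thesis
  proof (rule that)
    show "C \<ge> 1" using \<tau> by (simp add: C_def)
  next
    fix n
    define m where "m z = \<lceil>n * max 1 (cmod z) ^ n / \<tau>\<rceil>" for z :: complex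
    have m0: "0 \<le> m z" for z
    proof -
      have "0 \<le> n * max 1 (cmod z) ^ n / \<tau>" using \<tau> by (intro divide_nonneg_nonneg mult_nonneg_nonneg) auto
      thus ?thesis unfolding m_def by linarith
    qed
    have "\<Phi> ` sign_polys n \<subseteq> (\<Pi>\<^sub>E z\<in>R. {- m z..m z})"
    proof (intro image_subsetI)
      fix q assume q: "q \<in> sign_polys n"
      have "\<lfloor>real_form z q / \<tau>\<rfloor> \<in> {- m z..m z}" for z
      proof -
        have "\<bar>real_form z q / \<tau>\<bar> \<le> n * max 1 (cmod z) ^ n / \<tau>"
          using abs_real_form_sign_poly_le[OF q, of z] \<tau> by (simp add: abs_divide divide_right_mono)
        hence "real_form z q / \<tau> \<le> n * max 1 (cmod z) ^ n / \<tau>"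
          "- (n * max 1 (cmod z) ^ n / \<tau>) \<le> real_form z q / \<tau>" by linarith+
        thus ?thesis unfolding m_def atLeastAtMost_iff by (intro conjI) linarith+
      qed
      thus "\<Phi> q \<in> (\<Pi>\<^sub>E z\<in>R. {- m z..m z})" by (auto simp: \<Phi>_def)
    qed
    moreover have "finite (\<Pi>\<^sub>E z\<in>R. {- m z..m z})" using fin by (intro finite_PiE) auto
    ultimately have "card (\<Phi> ` sign_polys n) \<le> card (\<Pi>\<^sub>E z\<in>R. {- m z..m z})" by (intro card_mono)
    hence "card ((\<lambda>q. poly (of_int_poly q) a) ` sign_polys n) \<le> card (\<Pi>\<^sub>E z\<in>R. {- m z..m z})"
      using card_image_le_card_image[OF finite_sign_polys, of n \<Phi> "\<lambda>q. poly (of_int_poly q) a"] same_cell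
      by (meson order_trans)
    also have "\<dots> = (\<Prod>z\<in>R. nat (2 * m z + 1))"
      using fin by (subst card_PiE) (auto intro!: prod.cong simp: algebra_simps)
    finally have "real (card ((\<lambda>q. poly (of_int_poly q) a) ` sign_polys n)) \<le> (\<Prod>z\<in>R. real (nat (2 * m z + 1)))"
      by (simp only: of_nat_prod[symmetric] of_nat_le_iff)
    also have "\<dots> \<le> (\<Prod>z\<in>R. C * (real n + 1) * max 1 (cmod z) ^ n)"
    proof (intro prod_mono conjI)
      fix z
      define x where "x = max 1 (cmod z) ^ n"
      have x: "x \<ge> 1" unfolding x_def by (intro one_le_power) auto
      have "real (nat (2 * m z + 1)) = 2 * m z + 1" using m0[of z] by simp
      also have "\<dots> \<le> 2 * (n * x / \<tau>) + 3" unfolding m_def x_def by linarith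
      also have "\<dots> \<le> 2 * (n * x / \<tau>) + 3 * ((real n + 1) * x)"
      proof -
        have "1 * 1 \<le> (real n + 1) * x" using x by (intro mult_mono) auto
        thus ?thesis by (simp add: add.commute)
      qed
      also have "\<dots> \<le> 2 * ((real n + 1) * x / \<tau>) + 3 * ((real n + 1) * x)"
        using x \<tau> by (intro add_right_mono mult_left_mono divide_right_mono mult_right_mono) auto
      also have "\<dots> = C * (real n + 1) * x" by (simp add: C_def distrib_right)
      finally show "real (nat (2 * m z + 1)) \<le> C * (real n + 1) * max 1 (cmod z) ^ n" by (simp add: x_def)
    qed auto
    also have "\<dots> = (C * (real n + 1)) ^ degree p * (\<Prod>z\<in>R. max 1 (cmod z)) ^ n"
      by (simp add: prod.distrib card prod_power_distrib)
    also have "(\<Prod>z\<in>R. max 1 (cmod z)) = mahler_measure p"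
    proof -
      have "\<bar>real_of_int (lead_coeff p)\<bar> = 1" using lead by (metis of_int_1 of_int_abs)
      thus ?thesis using mahler_measure_irreducible[OF irr deg] by (simp add: R_def)
    qed
    finally show "card ((\<lambda>q. poly (of_int_poly q) a) ` sign_polys n) \<le> (C * (real n + 1)) ^ degree p * mahler_measure p ^ n" .
  qed
qed

text \<open>
  The entropy is at most the logarithm of the number of values; the polynomial factor in the count
  disappears in the limit.
\<close>

lemma bernoulli_entropy_le_log_mahler:
  assumes "algebraic a"
  shows "bernoulli_entropy a \<le> log 2 (mahler_measure_of a)"
proof -
  define p where "p = int_minpoly a"
  have irr: "irreducible p" and a: "poly (of_int_poly p) a = 0"
    using int_minpoly[OF assms] by (auto simp: p_def)
  have deg: "degree p > 0" using irr a by (rule irreducible_root_imp_degree_pos)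
  define M where "M = mahler_measure_of a"
  have M_eq: "M = mahler_measure p" by (simp add: M_def p_def mahler_measure_of_def)
  have "p \<noteq> 0" using deg by auto
  hence M1: "M \<ge> 1" unfolding M_eq by (rule mahler_measure_poly_ge_1)
  show ?thesis
  proof (cases "\<bar>lead_coeff p\<bar> \<ge> 2")
    case True
    have "2 * 1 \<le> \<bar>real_of_int (lead_coeff p)\<bar> * (\<Prod>z | poly (of_int_poly p) z = 0. max 1 (cmod z))"
    proof (intro mult_mono prod_ge_1)
      show "2 \<le> \<bar>real_of_int (lead_coeff p)\<bar>" using True by linarith
    qed auto
    hence "2 \<le> M" unfolding M_eq mahler_measure_irreducible[OF irr deg] by simp
    hence "1 \<le> log 2 M" by (subst le_log_iff) auto
    thus ?thesis using bernoulli_entropy_le_1[of a] by (simp add: M_def)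
  next
    case False
    moreover have "lead_coeff p \<noteq> 0" using deg by auto
    ultimately have lead: "\<bar>lead_coeff p\<bar> = 1" by linarith
    obtain C :: real where C: "C \<ge> 1" and card:
      "\<And>n. card ((\<lambda>q. poly (of_int_poly q) a) ` sign_polys n) \<le> (C * (real n + 1)) ^ degree p * mahler_measure p ^ n"
      by (rule card_values_le_mahler[OF irr a lead]) blast
    have le: "shannon_entropy (bernoulli_sum_pmf a n) / n \<le> degree p * (log 2 (C * (real n + 1)) / n) + log 2 M"
      if n: "n \<ge> 1" for n
    proof -
      let ?V = "set_pmf (bernoulli_sum_pmf a n)"
      have V: "?V = (\<lambda>q. poly (of_int_poly q) a) ` sign_polys n"
        by (simp add: bernoulli_sum_pmf_eq_sign_polys finite_sign_polys sign_polys_nonempty)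
      have pos: "0 < C * (real n + 1)" using C by (intro mult_pos_pos) auto
      have "0 < card ?V" by (simp only: card_gt_0_iff finite_set_bernoulli_sum set_pmf_not_empty simp_thms)
      hence "log 2 (card ?V) \<le> log 2 ((C * (real n + 1)) ^ degree p * M ^ n)"
        using card[of n] by (intro log_mono) (auto simp: V M_eq add.commute)
      also have "\<dots> = degree p * log 2 (C * (real n + 1)) + n * log 2 M"
        using pos M1 by (subst log_mult_pos) (auto simp: log_nat_power)
      finally have "shannon_entropy (bernoulli_sum_pmf a n) \<le> degree p * log 2 (C * (real n + 1)) + n * log 2 M"
        using shannon_entropy_le_log_card[OF finite_set_bernoulli_sum[of a n]] by linarith
      hence "shannon_entropy (bernoulli_sum_pmf a n) / n \<le> (degree p * log 2 (C * (real n + 1)) + n * log 2 M) / n"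
        by (rule divide_right_mono) simp
      also have "\<dots> = degree p * (log 2 (C * (real n + 1)) / n) + log 2 M"
        using n by (simp add: add_divide_distrib add.commute)
      finally show ?thesis .
    qed
    have "(\<lambda>n. log 2 (C * (real n + 1)) / n) \<longlonglongrightarrow> 0"
      using C by real_asymp
    hence "(\<lambda>n. degree p * (log 2 (C * (real n + 1)) / n) + log 2 M) \<longlonglongrightarrow> real (degree p) * 0 + log 2 M"
      by (intro tendsto_add tendsto_mult tendsto_const)
    hence "(\<lambda>n. degree p * (log 2 (C * (real n + 1)) / n) + log 2 M) \<longlonglongrightarrow> log 2 M" by simp
    from LIMSEQ_le[OF bernoulli_entropy_LIMSEQ this] le
    show ?thesis unfolding M_def by blast
  qed
qed

theorem theorem5:
  shows "\<exists>c::real. c > 0 \<and> (\<forall>a::complex. algebraic a \<longrightarrow>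
    c * min 1 (log 2 (mahler_measure_of a)) \<le> bernoulli_entropy a \<and>
    bernoulli_entropy a \<le> min 1 (log 2 (mahler_measure_of a)))"
proof (intro exI[of _ "1 / 16"] conjI allI impI)
  fix a :: complex assume a: "algebraic a"
  show "1 / 16 * min 1 (log 2 (mahler_measure_of a)) \<le> bernoulli_entropy a"
    using a by (rule bernoulli_entropy_ge_mahler)
  show "bernoulli_entropy a \<le> min 1 (log 2 (mahler_measure_of a))"
    using bernoulli_entropy_le_1 bernoulli_entropy_le_log_mahler[OF a] by simp
qed simp

end
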